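(* Let $M'$ and $M$ be lattice path matroids on $[n]$ without loops or coloops. The following are equivalent: (i) $M'\leq_Q M$; (ii) $M'\trianglelefteq_Q M$; (iii) every interval of $M$ can be expressed as a union of intervals of $M'$.
   Context: $[n]=\{1,\dots,n\}$. For $A=\{a_1<\dots<a_k\}$, $B=\{b_1<\dots<b_k\}$ in $\binom{[n]}{k}$, $A\leq_G B$ (Gale order) iff $a_i\leq b_i$ for all $i$. For $U\leq_G L$ in $\binom{[n]}{k}$, the lattice path matroid (LPM) $M[U,L]$ is the matroid of rank $k$ on $[n]$ with set of bases $\{B\in\binom{[n]}{k}: U\leq_G B\leq_G L\}$. Quotient: for matroids $M,M'$ on $[n]$ with sets of bases $\mathcal B,\mathcal B'$, $M'\leq_Q M$ if for all $B\in\mathcal B$ and $p\in[n]\setminus B$ there is $B'\in\mathcal B'$ with $B'\subseteq B$ such that for all $q\in B'$: if $(B'\cup\{p\})\setminus\{q\}\in\mathcal B'$ then $(B\cup\{p\})\setminus\{q\}\in\mathcal B$. Realizable quotient: $\mathrm{Gr}_{k,n}^{\geq 0}$ is the set of $k$-dimensional subspaces of $\mathbb R^n$ that are the row span of some full rank $k\times n$ real matrix all of whose maximal minors are nonnegative. A full rank $k\times n$ matrix $A$ represents the matroid on $[n]$ whose bases are the $k$-sets of columns with nonzero $k\times k$ minor; positroids are the matroids represented by matrices whose row span lies in $\mathrm{Gr}_{k,n}^{\geq 0}$ (every LPM is a positroid). For positroids $M',M$ on $[n]$ of ranks $k\leq \ell$, respectively, $M'\trianglelefteq_Q M$ means that there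 is a full rank $\ell\times n$ matrix $A$ representing $M$, with row span in $\mathrm{Gr}_{\ell,n}^{\geq0}$, such that the submatrix $A'$ consisting of its top $k$ rows represents $M'$ and has row span in $\mathrm{Gr}_{k,n}^{\geq 0}$. Intervals: let $M=M[U,L]$ be an LPM on $[n]$ without loops or coloops, $U=\{u_1<\dots<u_k\}$, $L=\{\ell_1<\dots<\ell_k\}$, and $[n]\setminus U=\{\overline u_1<\dots<\overline u_{n-k}\}$, $[n]\setminus L=\{\overline\ell_1<\dots<\overline\ell_{n-k}\}$. A row-interval of $M$ is a cyclic interval $\{\ell_i,\ell_i+1,\dots,n,1,\dots,u_i\}$ for $i\in\{1,\dots,k\}$. A column-interval of $M$ is an interval $\{\overline\ell_i,\overline\ell_i+1,\dots,\overline u_i\}$ for $i\in\{1,\dots,n-k\}$. An interval of $M$ is a row-interval or a column-interval of $M$. *)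

theory Defs
  imports Complex_Main "Jordan_Normal_Form.DL_Rank_Submatrix"
begin

(* The ground set [n] is {1..n}, and a matroid on [n] is given by its set of bases. *)

definition ksubsets :: "nat \<Rightarrow> nat \<Rightarrow> nat set set" where
  "ksubsets n k = {A. A \<subseteq> {1..n} \<and> card A = k}"

(* Positions count from 0: nth_smallest A i is the (i+1)-st smallest element of A. *)

definition nth_smallest :: "nat set \<Rightarrow> nat \<Rightarrow> nat" where
  "nth_smallest A i = sorted_list_of_set A ! i"

definition gale_le :: "nat set \<Rightarrow> nat set \<Rightarrow> bool" where
  "gale_le A B \<longleftrightarrow> card A = card B \<and> (\<forall>i<card A. nth_smallest A i \<le> nth_smallest B i)"

definition lpm :: "nat \<Rightarrow> nat \<Rightarrow> nat set \<Rightarrow> nat set \<Rightarrow> nat set set" where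
  "lpm n k U L = {B \<in> ksubsets n k. gale_le U B \<and> gale_le B L}"

definition loop :: "nat \<Rightarrow> nat set set \<Rightarrow> nat \<Rightarrow> bool" where
  "loop n \<B> e \<longleftrightarrow> e \<in> {1..n} \<and> (\<forall>B\<in>\<B>. e \<notin> B)"

definition coloop :: "nat \<Rightarrow> nat set set \<Rightarrow> nat \<Rightarrow> bool" where
  "coloop n \<B> e \<longleftrightarrow> e \<in> {1..n} \<and> (\<forall>B\<in>\<B>. e \<in> B)"

definition loopless_coloopless :: "nat \<Rightarrow> nat set set \<Rightarrow> bool" where
  "loopless_coloopless n \<B> \<longleftrightarrow> (\<forall>e. \<not> loop n \<B> e \<and> \<not> coloop n \<B> e)"

definition matroid_quotient :: "nat \<Rightarrow> nat set set \<Rightarrow> nat set set \<Rightarrow> bool" where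
  "matroid_quotient n \<B>' \<B> \<longleftrightarrow>
     (\<forall>B\<in>\<B>. \<forall>p\<in>{1..n} - B. \<exists>B'\<in>\<B>'. B' \<subseteq> B \<and>
        (\<forall>q\<in>B'. (B' \<union> {p}) - {q} \<in> \<B>' \<longrightarrow> (B \<union> {p}) - {q} \<in> \<B>))"

definition full_rank_mats :: "nat \<Rightarrow> nat \<Rightarrow> real mat set" where
  "full_rank_mats k n = {A \<in> carrier_mat k n. vec_space.rank k A = k}"

(* Matrix columns are indexed from 0, so element e of [n] labels column e - 1. *)

definition maximal_minor :: "real mat \<Rightarrow> nat set \<Rightarrow> real" where
  "maximal_minor A B = det (submatrix A UNIV {j. Suc j \<in> B})"

definition tnn_grassmannian :: "nat \<Rightarrow> nat \<Rightarrow> real vec set set" where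
  "tnn_grassmannian k n =
     {vec_space.row_space n A |A. A \<in> full_rank_mats k n \<and> (\<forall>B\<in>ksubsets n k. 0 \<le> maximal_minor A B)}"

definition represents :: "nat \<Rightarrow> nat \<Rightarrow> real mat \<Rightarrow> nat set set \<Rightarrow> bool" where
  "represents k n A \<B> \<longleftrightarrow>
     A \<in> full_rank_mats k n \<and> \<B> = {B \<in> ksubsets n k. maximal_minor A B \<noteq> 0}"

(* A represented matroid has as rank the number of rows of the matrix, so k and l below
   are necessarily the ranks of the two matroids. *)

definition realizable_quotient :: "nat \<Rightarrow> nat set set \<Rightarrow> nat set set \<Rightarrow> bool" where
  "realizable_quotient n \<B>' \<B> \<longleftrightarrow>
     (\<exists>k l A. k \<le> l \<and>
        represents l n A \<B> \<and> vec_space.row_space n A \<in> tnn_grassmannian l n \<and>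
        represents k n (submatrix A {..<k} UNIV) \<B>' \<and>
        vec_space.row_space n (submatrix A {..<k} UNIV) \<in> tnn_grassmannian k n)"

(* The cyclic interval from a to b, written for b < a; this is the case needed, because
   u_i = l_i would make that element a coloop of M[U,L]. *)

definition row_intervals :: "nat \<Rightarrow> nat set \<Rightarrow> nat set \<Rightarrow> nat set set" where
  "row_intervals n U L =
     {{nth_smallest L i..n} \<union> {1..nth_smallest U i} |i. i < card U}"

definition column_intervals :: "nat \<Rightarrow> nat set \<Rightarrow> nat set \<Rightarrow> nat set set" where
  "column_intervals n U L =
     {{nth_smallest ({1..n} - L) i..nth_smallest ({1..n} - U) i} |i. i < card ({1..n} - U)}"

definition lpm_intervals :: "nat \<Rightarrow> nat set \<Rightarrow> nat set \<Rightarrow> nat set set" where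
  "lpm_intervals n U L = row_intervals n U L \<union> column_intervals n U L"

end

theory Submission
  imports Defs
begin

text \<open>
  Throughout, \<open>cnt A y\<close> is the number of elements of \<open>A\<close> up to \<open>y\<close>.  A set \<open>B\<close> of the right size is a basis
  of the lattice path matroid of \<open>U\<close> and \<open>L\<close> if and only if \<open>cnt L \<le> cnt B \<le> cnt U\<close> pointwise.  The equivalence
  is proved as a cycle of three implications.

  \<^item> A quotient gives covers of intervals.  For a basis \<open>B\<close> and an element \<open>x\<close> outside it, all exchanges of \<open>x\<close> for
    an element of \<open>B\<close> stay inside \<open>{a..b}\<close> only if \<open>cnt B\<close> meets \<open>cnt L\<close> somewhere from \<open>a - 1\<close> to \<open>x - 1\<close> and \<open>cnt U\<close>
    somewhere from \<open>x\<close> to \<open>b\<close> (\<open>tight_if_exchange_confined\<close>), and two such contacts enclose a column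
    interval through \<open>x\<close> (\<open>column_interval_at_basis\<close>).  Column intervals are fundamental circuits
    (\<open>column_basis\<close>), and the definition of a quotient carries the confinement of exchanges
    from \<open>M\<close> to \<open>M'\<close>.  For a row interval of \<open>M\<close> it is
    enough to find a basis of \<open>M\<close> inside it that avoids \<open>x\<close> (\<open>row_basis\<close>), since a basis of \<open>M'\<close> contained
    in it leads to an interval of \<open>M'\<close> through \<open>x\<close> (\<open>row_cover\<close>).

  \<^item> Covers of intervals give a nonnegative flag.  Comparing end points of intervals shows that \<open>U'\<close> is a subset
    of \<open>U\<close> and \<open>L'\<close> one of \<open>L\<close>, so that row \<open>i\<close> of \<open>M'\<close> begins where some row \<open>p i\<close> of \<open>M\<close> begins and ends where some row
    \<open>q i\<close> ends; moreover \<open>p i \<le> q i\<close>.  Let \<open>T\<close> have the entry \<open>c ^ (i * j)\<close> for \<open>j\<close> in row \<open>i\<close> of \<open>M\<close> and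
    \<open>0\<close> elsewhere, and let \<open>X\<close> have \<open>c ^ (i * j)\<close> for \<open>p i \<le> j \<le> q i\<close>.  For large \<open>c\<close> a minor of such a
    matrix is positive if its diagonal lies in the support and zero otherwise (\<open>staircase_minor\<close>).  Hence \<open>T\<close>
    represents \<open>M\<close>, and by the Cauchy-Binet formula \<open>X T\<close> has nonnegative maximal minors, which are nonzero
    on those sets to which increasing rows of \<open>M\<close> can be assigned within the limits of \<open>p\<close> and \<open>q\<close>.  These are the bases of
    \<open>M'\<close> (\<open>rows_selectable\<close>), because a basis of \<open>M'\<close> is independent in \<open>M\<close> (\<open>basis_count_bound\<close>).
    If \<open>Z\<close> extends \<open>X\<close> to a square matrix with positive determinant, then \<open>Z T\<close> is the desired matrix.

  \<^item> A realizable quotient is a quotient, because linear relations among columns restrict to the top rows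
    (\<open>top_rows_quotient\<close>).
\<close>

section \<open>Counting elements up to a bound\<close>

definition cnt :: "nat set \<Rightarrow> nat \<Rightarrow> nat" where
  "cnt A y = card (A \<inter> {..y})"

lemma nth_smallest_in: "finite A \<Longrightarrow> i < card A \<Longrightarrow> nth_smallest A i \<in> A"
  unfolding nth_smallest_def
  using nth_mem[of i "sorted_list_of_set A"] by simp

lemma nth_smallest_less: "finite A \<Longrightarrow> i < j \<Longrightarrow> j < card A \<Longrightarrow> nth_smallest A i < nth_smallest A j"
  unfolding nth_smallest_def
  using sorted_wrt_nth_less[of "(<)" "sorted_list_of_set A" i j] by simp

lemma nth_smallest_mono: "finite A \<Longrightarrow> i \<le> j \<Longrightarrow> j < card A \<Longrightarrow> nth_smallest A i \<le> nth_smallest A j"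
  using nth_smallest_less[of A i j] by (cases "i = j") auto

lemma nth_smallest_inj: "finite A \<Longrightarrow> inj_on (nth_smallest A) {..<card A}"
  by (rule linorder_inj_onI) (auto dest: nth_smallest_less)

lemma nth_smallest_image: assumes "finite A" shows "nth_smallest A ` {..<card A} = A"
proof (rule card_subset_eq[OF assms])
  show "nth_smallest A ` {..<card A} \<subseteq> A" using nth_smallest_in[OF assms] by auto
  show "card (nth_smallest A ` {..<card A}) = card A"
    using card_image[OF nth_smallest_inj[OF assms]] by simp
qed

lemma index_of_member: "finite A \<Longrightarrow> a \<in> A \<Longrightarrow> \<exists>i<card A. nth_smallest A i = a"
  using nth_smallest_image[of A] by (metis imageE lessThan_iff)

lemma nth_smallest_unique:
  assumes mono: "\<And>i j. i < j \<Longrightarrow> j < m \<Longrightarrow> f i < (f j :: nat)" and "i < m"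
  shows "nth_smallest (f ` {..<m}) i = f i"
proof -
  have "sorted_wrt (<) (map f [0..<m])"
    using mono by (auto simp: sorted_wrt_iff_nth_less)
  moreover have "set (map f [0..<m]) = f ` {..<m}" by auto
  ultimately have "sorted_list_of_set (f ` {..<m}) = map f [0..<m]"
    using strict_sorted_equal[of "map f [0..<m]" "sorted_list_of_set (f ` {..<m})"] by simp
  then show ?thesis using assms(2) by (simp add: nth_smallest_def)
qed

lemma cnt_nth_smallest:
  assumes "finite A" "i < card A" shows "cnt A (nth_smallest A i) = Suc i"
proof -
  have "A \<inter> {..nth_smallest A i} = nth_smallest A ` {..i}" (is "?l = ?r")
  proof
    show "?r \<subseteq> ?l" using nth_smallest_in nth_smallest_mono assms by fastforce
    show "?l \<subseteq> ?r"
    proof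
      fix x assume x: "x \<in> ?l"
      then obtain j where j: "j < card A" "x = nth_smallest A j"
        using nth_smallest_image[OF assms(1)] by (metis IntD1 imageE lessThan_iff)
      then have "j \<le> i" using x nth_smallest_less[OF assms(1), of i j] by (cases "i < j") auto
      then show "x \<in> ?r" using j by auto
    qed
  qed
  moreover have "inj_on (nth_smallest A) {..i}"
    by (rule inj_on_subset[OF nth_smallest_inj[OF assms(1)]]) (use assms in auto)
  ultimately show ?thesis by (simp add: cnt_def card_image)
qed

lemma cnt_mono: "finite A \<Longrightarrow> y \<le> z \<Longrightarrow> cnt A y \<le> cnt A z"
  unfolding cnt_def by (rule card_mono) auto

lemma cnt_le_card: "finite A \<Longrightarrow> cnt A y \<le> card A"
  unfolding cnt_def by (rule card_mono) auto

text \<open>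
  Counting elements up to a bound and listing elements in increasing order are Galois-adjoint.
  All order statements about bases are therefore stated as comparisons of counts, which add up
  over consecutive intervals; with \<open>gale_le_iff_cnt\<close> the Gale order becomes the pointwise order of counting
  functions.
\<close>

lemma nth_smallest_le_iff:
  assumes "finite A" "i < card A" shows "nth_smallest A i \<le> y \<longleftrightarrow> i < cnt A y"
proof
  assume "nth_smallest A i \<le> y" then show "i < cnt A y"
    using cnt_mono[OF assms(1)] cnt_nth_smallest[OF assms] by (metis Suc_le_lessD)
next
  assume "i < cnt A y"
  show "nth_smallest A i \<le> y"
  proof (rule ccontr)
    assume neg: "\<not> nth_smallest A i \<le> y"
    have "A \<inter> {..y} \<subseteq> A \<inter> {..nth_smallest A i} - {nth_smallest A i}" using neg by auto
    then have "cnt A y \<le> card (A \<inter> {..nth_smallest A i} - {nth_smallest A i})"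
      unfolding cnt_def by (rule card_mono[rotated]) auto
    also have "\<dots> = i"
      using cnt_nth_smallest[OF assms] nth_smallest_in[OF assms] by (simp add: cnt_def)
    finally show False using \<open>i < cnt A y\<close> by simp
  qed
qed

lemma cnt_diff:
  assumes "finite A" "y \<le> z" shows "cnt A z = cnt A y + card (A \<inter> {y<..z})"
proof -
  have "A \<inter> {..z} = (A \<inter> {..y}) \<union> (A \<inter> {y<..z})" using assms(2) by auto
  then show ?thesis unfolding cnt_def
    by (simp only:) (subst card_Un_disjoint, use assms(1) in auto)
qed

lemma cnt_diff_le:
  assumes "finite A" "y \<le> z" shows "cnt A z \<le> cnt A y + (z - y)"
  using cnt_diff[OF assms] card_mono[of "{y<..z}" "A \<inter> {y<..z}"] by simp

lemma cnt_diff_less: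
  assumes "finite A" "x \<notin> A" "y < x" "x \<le> z" shows "cnt A z < cnt A y + (z - y)"
proof -
  have "A \<inter> {y<..z} \<subseteq> {y<..z} - {x}" using assms(2) by blast
  then have "card (A \<inter> {y<..z}) \<le> card ({y<..z} - {x})" by (rule card_mono[rotated]) simp
  also have "\<dots> = z - y - 1" using assms(3,4) by simp
  finally show ?thesis using cnt_diff[of A y z] assms by linarith
qed

lemma cnt_eq_pred: "x \<notin> A \<Longrightarrow> cnt A x = cnt A (x - 1)"
proof -
  assume "x \<notin> A"
  then have "a \<le> x \<longleftrightarrow> a \<le> x - 1" if "a \<in> A" for a
    using that by (cases "a = x") auto
  then have "A \<inter> {..x} = A \<inter> {..x - 1}" by auto
  then show ?thesis by (simp add: cnt_def)
qed

lemma cnt_in_pred: assumes "finite A" "x \<in> A" "0 < x" shows "cnt A x = Suc (cnt A (x - 1))"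
proof -
  have "A \<inter> {..x} = insert x (A \<inter> {..x - 1})" using assms by auto
  then show ?thesis using assms by (simp add: cnt_def)
qed

lemma cnt_top: "A \<subseteq> {1..n} \<Longrightarrow> n \<le> y \<Longrightarrow> cnt A y = card A"
  unfolding cnt_def by (rule arg_cong[of _ _ card]) auto

lemma cnt_zero: "A \<subseteq> {1..n} \<Longrightarrow> cnt A 0 = 0"
  unfolding cnt_def by (auto simp: card_eq_0_iff)

lemma cnt_le: "A \<subseteq> {1..n} \<Longrightarrow> cnt A y \<le> y"
  using cnt_diff_le[of A 0 y] finite_subset[of A "{1..n}"] cnt_zero[of A n] by auto

lemma cnt_compl: assumes "A \<subseteq> {1..n}" "y \<le> n" shows "cnt ({1..n} - A) y = y - cnt A y"
proof -
  have "({1..n} - A) \<inter> {..y} = {1..y} - (A \<inter> {..y})" using assms by auto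
  moreover have "finite (A \<inter> {..y})" "A \<inter> {..y} \<subseteq> {1..y}" using assms by auto
  ultimately show ?thesis by (simp add: cnt_def card_Diff_subset)
qed

lemma cnt_nth_smallest_pred:
  assumes "A \<subseteq> {1..n}" "i < card A" shows "cnt A (nth_smallest A i - 1) = i"
proof -
  have f: "finite A" using assms finite_subset by blast
  then have "nth_smallest A i \<in> A" using nth_smallest_in assms by blast
  then show ?thesis using cnt_in_pred[OF f] cnt_nth_smallest[OF f assms(2)] assms(1) by force
qed

lemma gale_le_iff_cnt:
  assumes "A \<subseteq> {1..n}" "B \<subseteq> {1..n}" "card A = card B"
  shows "gale_le A B \<longleftrightarrow> (\<forall>y. cnt B y \<le> cnt A y)"
proof -
  have f: "finite A" "finite B" using assms finite_subset by blast+
  show ?thesis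
  proof
    assume g: "gale_le A B"
    show "\<forall>y. cnt B y \<le> cnt A y"
    proof (rule allI, rule ccontr)
      fix y assume "\<not> cnt B y \<le> cnt A y"
      then have lt: "cnt A y < cnt B y" by simp
      then have "cnt A y < card B" using cnt_le_card[OF f(2), of y] by simp
      then have "nth_smallest B (cnt A y) \<le> y" "\<not> nth_smallest A (cnt A y) \<le> y"
        using nth_smallest_le_iff f assms(3) lt by auto
      then show False using g \<open>cnt A y < card B\<close> assms(3) unfolding gale_le_def by fastforce
    qed
  next
    assume c: "\<forall>y. cnt B y \<le> cnt A y"
    have "nth_smallest A i \<le> nth_smallest B i" if "i < card A" for i
      using nth_smallest_le_iff[OF f(1) that] c cnt_nth_smallest[OF f(2), of i] that assms(3)
      by (metis Suc_le_lessD)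
    then show "gale_le A B" unfolding gale_le_def using assms(3) by simp
  qed
qed

lemma mem_lpm_iff_cnt:
  assumes "U \<in> ksubsets n k" "L \<in> ksubsets n k"
  shows "B \<in> lpm n k U L \<longleftrightarrow> B \<in> ksubsets n k \<and> (\<forall>y. cnt L y \<le> cnt B y \<and> cnt B y \<le> cnt U y)"
proof (cases "B \<in> ksubsets n k")
  case True
  then have "gale_le U B \<longleftrightarrow> (\<forall>y. cnt B y \<le> cnt U y)" "gale_le B L \<longleftrightarrow> (\<forall>y. cnt L y \<le> cnt B y)"
    using assms gale_le_iff_cnt[of U n B] gale_le_iff_cnt[of B n L] by (simp_all add: ksubsets_def)
  then show ?thesis using True unfolding lpm_def by blast
qed (simp add: lpm_def)

lemma cnt_swap:
  assumes "finite B" "q \<in> B" "x \<notin> B"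
  shows "cnt (insert x (B - {q})) y + (if q \<le> y then 1 else 0) = cnt B y + (if x \<le> y then 1 else 0)"
proof -
  have "insert x (B - {q}) \<inter> {..y} = (if x \<le> y then insert x ((B \<inter> {..y}) - {q}) else (B \<inter> {..y}) - {q})"
    by auto
  moreover have "card ((B \<inter> {..y}) - {q}) + (if q \<le> y then 1 else 0) = card (B \<inter> {..y})"
    using assms card_Suc_Diff1[of "B \<inter> {..y}" q] by (auto simp: Diff_triv)
  ultimately show ?thesis using assms by (simp add: cnt_def)
qed

lemma cnt_union:
  assumes "finite S" "finite T" "S \<inter> T = {}" shows "cnt (S \<union> T) y = cnt S y + cnt T y"
  unfolding cnt_def Int_Un_distrib2 by (rule card_Un_disjoint) (use assms in auto)

lemma cnt_below: "cnt (A \<inter> {..a}) y = cnt A (min y a)"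
  unfolding cnt_def by (rule arg_cong[of _ _ card]) auto

lemma cnt_above: assumes "finite A" shows "cnt (A \<inter> {c<..}) y = cnt A y - cnt A (min y c)"
proof -
  have "(A \<inter> {c<..}) \<inter> {..y} = (A \<inter> {..y}) - (A \<inter> {..min y c})" by auto
  moreover have "card ((A \<inter> {..y}) - (A \<inter> {..min y c})) = card (A \<inter> {..y}) - card (A \<inter> {..min y c})"
    using assms by (intro card_Diff_subset) auto
  ultimately show ?thesis by (simp only: cnt_def)
qed

lemma cnt_remove:
  assumes "finite A" "x \<in> A" shows "cnt (A - {x}) y = cnt A y - (if x \<le> y then 1 else 0)"
proof -
  have "(A - {x}) \<inter> {..y} = (A \<inter> {..y}) - {x}" by auto
  then show ?thesis using assms by (simp add: cnt_def Diff_triv)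
qed

lemma cnt_atLeastAtMost: "0 < a \<Longrightarrow> cnt {a..b} y = min y b + 1 - a"
proof -
  have "{a..b} \<inter> {..y} = {a..min y b}" by auto
  then show ?thesis by (simp add: cnt_def)
qed

section \<open>Determinants and the Cauchy-Binet formula\<close>

text \<open>
  Minors are taken of matrices whose entries are given by formulas, with rows and columns selected
  by reindexing.  Determinants of functions avoid carrying submatrices through these computations.
\<close>

definition fdet :: "nat \<Rightarrow> (nat \<Rightarrow> nat \<Rightarrow> real) \<Rightarrow> real" where
  "fdet m F = det (mat m m (\<lambda>(i, j). F i j))"

lemma fdet_expand:
  "fdet m F = (\<Sum>p | p permutes {..<m}. signof p * (\<Prod>i<m. F i (p i)))"
proof -
  have "(\<Prod>i<m. mat m m (\<lambda>(i, j). F i j) $$ (i, p i)) = (\<Prod>i<m. F i (p i))" if "p permutes {..<m}" for p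
    using permutes_in_image[OF that] by (intro prod.cong) auto
  then show ?thesis unfolding fdet_def
    by (subst det_def'[where n = m]) (auto simp: atLeast0LessThan intro!: sum.cong)
qed

lemma fdet_cong: "(\<And>i j. i < m \<Longrightarrow> j < m \<Longrightarrow> F i j = G i j) \<Longrightarrow> fdet m F = fdet m G"
  unfolding fdet_def by (rule arg_cong[of _ _ det]) (rule cong_mat; simp)

lemma fdet_transpose: "fdet m (\<lambda>i j. F j i) = fdet m F"
proof -
  have "mat m m (\<lambda>(i, j). F j i) = transpose_mat (mat m m (\<lambda>(i, j). F i j))"
    by (rule eq_matI) simp_all
  then show ?thesis unfolding fdet_def using det_transpose[of "mat m m (\<lambda>(i, j). F i j)" m] by simp
qed

lemma fdet_permute_rows:
  assumes "p permutes {..<m}" shows "fdet m (\<lambda>i. F (p i)) = signof p * fdet m F"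
proof -
  have "mat m m (\<lambda>(i, j). F (p i) j) = mat m m (\<lambda>(i, j). mat m m (\<lambda>(i, j). F i j) $$ (p i, j))"
    using permutes_in_image[OF assms] by (intro cong_mat) simp_all
  then show ?thesis unfolding fdet_def
    using det_permute_rows[of "mat m m (\<lambda>(i, j). F i j)" m p] assms by (simp add: atLeast0LessThan)
qed

lemma fdet_equal_rows:
  assumes "i < m" "j < m" "i \<noteq> j" "F i = F j" shows "fdet m F = 0"
  unfolding fdet_def
  by (rule det_identical_rows[of _ m i j]) (use assms in auto)

lemma fdet_negate_row:
  assumes "r < m" shows "fdet m (\<lambda>i j. if i = r then - F i j else F i j) = - fdet m F"
proof -
  have "(\<Prod>i<m. if i = r then - F i (p i) else F i (p i)) = - (\<Prod>i<m. F i (p i))" for p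
    using assms by (simp add: prod.remove[of "{..<m}" r])
  then show ?thesis by (simp add: fdet_expand sum_negf)
qed

lemma fdet_kernel:
  "fdet m F = 0 \<longleftrightarrow> (\<exists>x. (\<exists>j<m. x j \<noteq> 0) \<and> (\<forall>i<m. (\<Sum>j<m. F i j * x j) = 0))"
proof -
  let ?A = "mat m m (\<lambda>(i, j). F i j)"
  have row: "(?A *\<^sub>v v) $ i = (\<Sum>j<m. F i j * v $ j)" if "i < m" "v \<in> carrier_vec m" for i v
    using that by (simp add: scalar_prod_def atLeast0LessThan)
  have "fdet m F = 0 \<longleftrightarrow> (\<exists>v. v \<in> carrier_vec m \<and> v \<noteq> 0\<^sub>v m \<and> ?A *\<^sub>v v = 0\<^sub>v m)"
    unfolding fdet_def by (rule det_0_iff_vec_prod_zero) simp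
  also have "\<dots> \<longleftrightarrow> (\<exists>x. (\<exists>j<m. x j \<noteq> 0) \<and> (\<forall>i<m. (\<Sum>j<m. F i j * x j) = 0))" (is "?l = ?r")
  proof
    assume ?l
    then obtain v where v: "v \<in> carrier_vec m" "v \<noteq> 0\<^sub>v m" "?A *\<^sub>v v = 0\<^sub>v m" by blast
    then have "\<exists>j<m. v $ j \<noteq> 0" by (metis carrier_vecD eq_vecI index_zero_vec)
    moreover have "\<forall>i<m. (\<Sum>j<m. F i j * v $ j) = 0" using row v by (metis index_zero_vec(1))
    ultimately show ?r by blast
  next
    assume ?r
    then obtain x where x: "\<exists>j<m. x j \<noteq> 0" "\<forall>i<m. (\<Sum>j<m. F i j * x j) = 0" by blast
    have "vec m x \<noteq> 0\<^sub>v m" using x(1) by (metis index_vec index_zero_vec(1))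
    moreover have "?A *\<^sub>v vec m x = 0\<^sub>v m"
      using x(2) row[of _ "vec m x"] by (intro eq_vecI) auto
    ultimately show ?l by (metis vec_carrier)
  qed
  finally show ?thesis .
qed

lemma fdet_solve:
  assumes "fdet m F \<noteq> 0" shows "\<exists>x. \<forall>i<m. (\<Sum>j<m. F i j * x j) = y i"
proof -
  let ?A = "mat m m (\<lambda>(i, j). F i j)"
  have "?A \<in> Units (ring_mat TYPE(real) m ())"
    using assms det_non_zero_imp_unit[of ?A m] by (simp add: fdet_def)
  then obtain C where C: "C \<in> carrier_mat m m" "?A * C = 1\<^sub>m m"
    unfolding Units_def by (auto simp: ring_mat_def)
  define v where "v = C *\<^sub>v vec m y"
  have v: "v \<in> carrier_vec m" using C unfolding v_def by simp
  have "?A *\<^sub>v v = vec m y"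
    unfolding v_def using C assoc_mult_mat_vec[of ?A m m C m "vec m y"] by simp
  then have "(?A *\<^sub>v v) $ i = y i" if "i < m" for i using that by simp
  then have "(\<Sum>j<m. F i j * v $ j) = y i" if "i < m" for i
    using that v by (simp add: scalar_prod_def atLeast0LessThan)
  then show ?thesis by blast
qed

text \<open>
  An injective choice of rows is a set of rows together with an order on it; in the Cauchy-Binet
  formula the order contributes the sign.
\<close>

lemma permutation_of_indices:
  assumes "inj_on f {..<m}" "f ` {..<m} = (J :: nat set)"
  shows "\<exists>p. p permutes {..<m} \<and> (\<forall>i<m. f i = nth_smallest J (p i))"
proof -
  have J: "finite J" "card J = m" using assms card_image[OF assms(1)] by auto
  have bij: "bij_betw (nth_smallest J) {..<m} J"
    using nth_smallest_inj[OF J(1)] nth_smallest_image[OF J(1)] J(2) by (simp add: bij_betw_def)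
  define g where "g = inv_into {..<m} (nth_smallest J)"
  define p where "p i = (if i < m then g (f i) else i)" for i
  have "bij_betw g J {..<m}" unfolding g_def by (rule bij_betw_inv_into[OF bij])
  moreover have "bij_betw f {..<m} J" using assms by (simp add: bij_betw_def)
  ultimately have "bij_betw (g \<circ> f) {..<m} {..<m}" by (rule bij_betw_trans[rotated])
  then have "bij_betw p {..<m} {..<m}" by (subst bij_betw_cong[of _ _ "g \<circ> f"]) (auto simp: p_def)
  then have "p permutes {..<m}" by (rule bij_imp_permutes) (auto simp: p_def)
  moreover have "f i = nth_smallest J (p i)" if "i < m" for i
    using that assms(2) bij by (auto simp: p_def g_def f_inv_into_f bij_betw_def)
  ultimately show ?thesis by blast
qed

text \<open>
  Expanding the product multilinearly in its rows gives one term for every function from rows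
  to indices.  Functions that repeat an index give a determinant with equal rows; the injective ones
  with image \<open>J\<close> are the rearrangements of \<open>J\<close>, and their signed sum is the minor of \<open>X\<close> on \<open>J\<close>.
\<close>

theorem cauchy_binet:
  "fdet m (\<lambda>i j. \<Sum>s<K. X i s * Y s j) =
     (\<Sum>J | J \<subseteq> {..<K} \<and> card J = m.
        fdet m (\<lambda>i t. X i (nth_smallest J t)) * fdet m (\<lambda>t. Y (nth_smallest J t)))"
proof -
  let ?P = "{p. p permutes {..<m}}" and ?F = "{..<m} \<rightarrow>\<^sub>E {..<K}"
  let ?I = "{f \<in> ?F. inj_on f {..<m}}"
  let ?Js = "{J. J \<subseteq> {..<K} \<and> card J = m}"
  let ?g = "\<lambda>(J, p). \<lambda>i\<in>{..<m}. nth_smallest J (p i)"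
  have finF: "finite ?F" by (intro finite_PiE) auto
  have fJ: "finite J" if "J \<in> ?Js" for J using that finite_subset by auto
  have "fdet m (\<lambda>i j. \<Sum>s<K. X i s * Y s j) =
      (\<Sum>p\<in>?P. signof p * (\<Sum>f\<in>?F. \<Prod>i<m. X i (f i) * Y (f i) (p i)))"
    unfolding fdet_expand by (subst prod_sum_PiE) auto
  also have "\<dots> = (\<Sum>f\<in>?F. \<Sum>p\<in>?P. signof p * (\<Prod>i<m. X i (f i) * Y (f i) (p i)))"
    unfolding sum_distrib_left by (rule sum.swap)
  also have "\<dots> = (\<Sum>f\<in>?F. (\<Prod>i<m. X i (f i)) * fdet m (\<lambda>i. Y (f i)))"
    unfolding fdet_expand sum_distrib_left prod.distrib by (intro sum.cong) auto
  also have "\<dots> = (\<Sum>f\<in>?I. (\<Prod>i<m. X i (f i)) * fdet m (\<lambda>i. Y (f i)))"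
  proof (rule sum.mono_neutral_right[OF finF])
    show "\<forall>f\<in>?F - ?I. (\<Prod>i<m. X i (f i)) * fdet m (\<lambda>i. Y (f i)) = 0"
    proof
      fix f assume "f \<in> ?F - ?I"
      then obtain i j where "i < m" "j < m" "i \<noteq> j" "f i = f j" unfolding inj_on_def by auto
      then show "(\<Prod>i<m. X i (f i)) * fdet m (\<lambda>i. Y (f i)) = 0"
        using fdet_equal_rows[of i m j "\<lambda>i. Y (f i)"] by simp
    qed
  qed auto
  also have "\<dots> = (\<Sum>Jp\<in>?Js \<times> ?P. (\<Prod>i<m. X i (?g Jp i)) * fdet m (\<lambda>i. Y (?g Jp i)))"
  proof (rule sum.reindex_bij_betw[symmetric])
    have inj: "inj_on ?g (?Js \<times> ?P)"
    proof (rule inj_onI, clarify)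
      fix J p J' p'
      assume J: "J \<subseteq> {..<K}" "m = card J" and J': "J' \<subseteq> {..<K}" "card J' = card J"
        and p: "p permutes {..<card J}" "p' permutes {..<card J}"
        and eq: "(\<lambda>i\<in>{..<card J}. nth_smallest J (p i)) = (\<lambda>i\<in>{..<card J}. nth_smallest J' (p' i))"
      have fin: "finite J" "finite J'" using J J' finite_subset by blast+
      have eqi: "nth_smallest J (p i) = nth_smallest J' (p' i)" if "i < card J" for i
        using fun_cong[OF eq, of i] that by simp
      have "J = nth_smallest J ` p ` {..<card J}"
        using permutes_image[OF p(1)] nth_smallest_image[OF fin(1)] by simp
      also have "\<dots> = nth_smallest J' ` p' ` {..<card J}"
        unfolding image_image using eqi by (intro image_cong) auto
      also have "\<dots> = J'" using permutes_image[OF p(2)] nth_smallest_image[OF fin(2)] J'(2) by simp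
      finally have JJ: "J = J'" .
      have "p i = p' i" for i
      proof (cases "i < card J")
        case True
        then show ?thesis using eqi[OF True] nth_smallest_inj[OF fin(1)] permutes_in_image p JJ
          by (metis inj_onD lessThan_iff)
      next
        case False
        then show ?thesis using p by (simp add: permutes_not_in)
      qed
      then show "J = J' \<and> p = p'" using JJ by auto
    qed
    have "?g ` (?Js \<times> ?P) = ?I"
    proof (intro equalityI subsetI)
      fix f assume "f \<in> ?g ` (?Js \<times> ?P)"
      then obtain J p where J: "J \<in> ?Js" and p: "p permutes {..<m}"
        and f: "f = (\<lambda>i\<in>{..<m}. nth_smallest J (p i))" by auto
      have "inj_on (nth_smallest J \<circ> p) {..<m}"
        using nth_smallest_inj[OF fJ[OF J]] J permutes_inj_on[OF p] permutes_image[OF p]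
        by (intro comp_inj_on) auto
      then have "inj_on f {..<m}" using f by (simp add: inj_on_def)
      moreover have "f \<in> ?F"
        using f J nth_smallest_in[OF fJ[OF J]] permutes_in_image[OF p] by (auto simp: PiE_def Pi_def)
      ultimately show "f \<in> ?I" by simp
    next
      fix f assume f: "f \<in> ?I"
      obtain p where p: "p permutes {..<m}" "\<forall>i<m. f i = nth_smallest (f ` {..<m}) (p i)"
        using permutation_of_indices[of f m] f by auto
      have "f = ?g (f ` {..<m}, p)"
        using f p(2) by (auto simp: fun_eq_iff PiE_def extensional_def)
      moreover have "f ` {..<m} \<in> ?Js" using f card_image[of f "{..<m}"] by (auto simp: PiE_def)
      ultimately show "f \<in> ?g ` (?Js \<times> ?P)" using p(1) by blast
    qed
    then show "bij_betw ?g (?Js \<times> ?P) ?I" using inj by (simp add: bij_betw_def)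
  qed
  also have "\<dots> = (\<Sum>J\<in>?Js. \<Sum>p\<in>?P. (\<Prod>i<m. X i (?g (J, p) i)) * fdet m (\<lambda>i. Y (?g (J, p) i)))"
    by (subst sum.cartesian_product) (auto intro!: sum.cong)
  also have "\<dots> = (\<Sum>J\<in>?Js. \<Sum>p\<in>?P. signof p * (\<Prod>i<m. X i (nth_smallest J (p i))) *
      fdet m (\<lambda>i. Y (nth_smallest J i)))"
  proof (intro sum.cong refl)
    fix J p assume "J \<in> ?Js" and p: "p \<in> ?P"
    have "fdet m (\<lambda>i. Y (?g (J, p) i)) = fdet m (\<lambda>i. Y (nth_smallest J (p i)))"
      by (rule fdet_cong) simp
    also have "\<dots> = signof p * fdet m (\<lambda>i. Y (nth_smallest J i))"
      using fdet_permute_rows[of p m "\<lambda>i. Y (nth_smallest J i)"] p by simp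
    finally show "(\<Prod>i<m. X i (?g (J, p) i)) * fdet m (\<lambda>i. Y (?g (J, p) i)) =
        signof p * (\<Prod>i<m. X i (nth_smallest J (p i))) * fdet m (\<lambda>i. Y (nth_smallest J i))"
      by (simp add: mult_ac)
  qed
  finally show ?thesis unfolding fdet_expand[of m "\<lambda>i t. X i (nth_smallest _ t)"]
    by (simp add: sum_distrib_right)
qed

lemma fdet_mult: "fdet m (\<lambda>i j. \<Sum>s<m. X i s * Y s j) = fdet m X * fdet m Y"
proof -
  have "{J. J \<subseteq> {..<m} \<and> card J = m} = {{..<m}}"
    using card_subset_eq[of "{..<m}"] by auto
  moreover have id: "nth_smallest {..<m} t = t" if "t < m" for t
    using nth_smallest_unique[of m "\<lambda>i. i" t] that by simp
  moreover have "fdet m (\<lambda>i t. X i (nth_smallest {..<m} t)) = fdet m X"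
    "fdet m (\<lambda>t. Y (nth_smallest {..<m} t)) = fdet m Y"
    by (rule fdet_cong; simp add: id)+
  ultimately show ?thesis unfolding cauchy_binet by simp
qed

text \<open>
  The shift by one occurs because columns are numbered from 0 and elements of the ground set from 1.
\<close>

lemma maximal_minor_eq_fdet:
  assumes M: "M \<in> carrier_mat k n" and B: "B \<in> ksubsets n k"
  shows "maximal_minor M B = fdet k (\<lambda>i j. M $$ (i, nth_smallest B j - 1))"
proof -
  let ?J = "{j. Suc j \<in> B}"
  have sub: "B \<subseteq> {1..n}" and card: "card B = k" and fin: "finite B"
    using B finite_subset by (auto simp: ksubsets_def)
  have image: "Suc ` ?J = B"
  proof (intro equalityI subsetI)
    fix b assume "b \<in> B"
    then have "b = Suc (b - 1)" using sub by force
    then show "b \<in> Suc ` ?J" using \<open>b \<in> B\<close> by (metis imageI mem_Collect_eq)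
  qed auto
  have "{j. j < n \<and> j \<in> ?J} = ?J" using sub by auto
  then have cols: "card {j. j < n \<and> j \<in> ?J} = k"
    using card_image[of Suc ?J] image card by simp
  have pick: "pick ?J j = nth_smallest B j - 1" if j: "j < k" for j
  proof -
    let ?b = "nth_smallest B j"
    have b: "?b \<in> B" using nth_smallest_in fin j card by simp
    then have b0: "0 < ?b" using sub by force
    have "Suc ` {a \<in> ?J. a < ?b - 1} = B \<inter> {..?b - 1}"
    proof (intro equalityI subsetI)
      fix a assume "a \<in> B \<inter> {..?b - 1}"
      then obtain a' where "a = Suc a'" "a' \<in> ?J" using image by blast
      then show "a \<in> Suc ` {a \<in> ?J. a < ?b - 1}" using \<open>a \<in> B \<inter> {..?b - 1}\<close> by simp
    qed auto
    then have "card {a \<in> ?J. a < ?b - 1} = cnt B (?b - 1)"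
      using card_image[of Suc "{a \<in> ?J. a < ?b - 1}"] unfolding cnt_def by simp
    then have "card {a \<in> ?J. a < ?b - 1} = j"
      using cnt_nth_smallest_pred[OF sub, of j] j card by simp
    moreover have "?b - 1 \<in> ?J" using b b0 by simp
    ultimately show ?thesis using pick_card_in_set[of "?b - 1" ?J] by simp
  qed
  have "submatrix M UNIV ?J = mat k k (\<lambda>(i, j). M $$ (i, nth_smallest B j - 1))"
    using M cols pick unfolding submatrix_def pick_UNIV by (intro cong_mat) auto
  then show ?thesis unfolding maximal_minor_def fdet_def by simp
qed

lemma (in vec_space) rank_le_dim:
  assumes "A \<in> carrier_mat n nc" shows "rank A \<le> n"
proof -
  have cols: "set (cols A) \<subseteq> carrier_vec n" using assms cols_dim by blast
  obtain S where S: "maximal S (\<lambda>T. T \<subseteq> set (cols A) \<and> lin_indpt T)"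
    using maximal_exists[of "(\<lambda>T. T \<subseteq> set (cols A) \<and> lin_indpt T)" "card (set (cols A))" "{}"]
    by (meson List.finite_set card_mono empty_iff empty_subsetI finite_lin_indpt2 rev_finite_subset)
  then have "S \<subseteq> carrier_vec n" "lin_indpt S" using cols by (auto simp: maximal_def)
  then have "card S \<le> n" using li_le_dim(2)[OF fin_dim] by (simp add: dim_is_n)
  then show ?thesis using rank_card_indpt[OF assms S] by simp
qed

lemma full_rank_if_minor_nonzero:
  assumes M: "M \<in> carrier_mat k n" and B: "B \<in> ksubsets n k" and nz: "maximal_minor M B \<noteq> 0"
  shows "M \<in> full_rank_mats k n"
proof -
  have "card {j. j < n \<and> Suc j \<in> B} \<le> vec_space.rank k M"
    using vec_space.rank_gt_minor[OF M, of UNIV "{j. Suc j \<in> B}"] nz by (simp add: maximal_minor_def)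
  moreover have "card {j. j < n \<and> Suc j \<in> B} = k"
  proof -
    have "Suc ` {j. j < n \<and> Suc j \<in> B} = B"
    proof (intro equalityI subsetI)
      fix b assume b: "b \<in> B"
      then have "b = Suc (b - 1)" "b - 1 < n" using B by (force simp: ksubsets_def)+
      then show "b \<in> Suc ` {j. j < n \<and> Suc j \<in> B}" using b by (metis (no_types, lifting) imageI mem_Collect_eq)
    qed auto
    then show ?thesis using card_image[of Suc "{j. j < n \<and> Suc j \<in> B}"] B by (simp add: ksubsets_def)
  qed
  moreover have "vec_space.rank k M \<le> k" 
    using vec_space.rank_le_dim[OF M] .
  ultimately show ?thesis using M by (simp add: full_rank_mats_def)
qed

section \<open>Staircase matrices\<close>

lemma permutation_without_inversion:
  assumes p: "p permutes {..<m::nat}" and "\<And>s t. s < t \<Longrightarrow> t < m \<Longrightarrow> p s < p t"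
  shows "p = id"
proof -
  have "nth_smallest (p ` {..<m}) i = p i" "nth_smallest (id ` {..<m}) i = id i" if "i < m" for i
    using that assms(2) by (intro nth_smallest_unique; simp)+
  then have "p i = i" if "i < m" for i
    using that permutes_image[OF p] by simp
  then show ?thesis using permutes_not_in[OF p] by (auto simp: fun_eq_iff)
qed

text \<open>
  Undoing an inversion strictly increases the sum, so that only a permutation without inversions can be
  a maximum.
\<close>

lemma rearrangement_strict:
  fixes r c :: "nat \<Rightarrow> nat"
  assumes r: "\<And>s t. s < t \<Longrightarrow> t < m \<Longrightarrow> r s < r t" and c: "\<And>s t. s < t \<Longrightarrow> t < m \<Longrightarrow> c s < c t"
    and p: "p permutes {..<m}" and "p \<noteq> id"
  shows "(\<Sum>t<m. r t * c (p t)) < (\<Sum>t<m. r t * c t)"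
proof -
  let ?P = "{p. p permutes {..<m}}" and ?w = "\<lambda>p. \<Sum>t<m. r t * c (p t)"
  have improve: "\<exists>q\<in>?P. ?w p < ?w q" if p: "p \<in> ?P" "p \<noteq> id" for p
  proof -
    have inj: "inj p" using p permutes_inj by blast
    obtain s t where st: "s < t" "t < m" "\<not> p s < p t"
      using permutation_without_inversion[of p m] p by blast
    then have lt: "p t < p s" using inj injD[OF inj, of s t] by (cases "p s = p t") auto
    let ?q = "p \<circ> transpose s t"
    have q: "?q permutes {..<m}"
      using st p by (intro permutes_compose permutes_swap_id) auto
    have "p s < m" using permutes_in_image[of p "{..<m}" s] p st by auto
    then have "r s < r t" "c (p t) < c (p s)" using r[OF st(1,2)] c[OF lt] by auto
    then have "r s * c (p s) + r t * c (p t) < r s * c (p t) + r t * c (p s)"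
    proof -
      obtain d e where "r t = r s + Suc d" "c (p s) = c (p t) + Suc e"
        using \<open>r s < r t\<close> \<open>c (p t) < c (p s)\<close> less_imp_Suc_add by (metis add_Suc_right)
      then show ?thesis by (simp add: algebra_simps)
    qed
    moreover have split: "?w f = (\<Sum>i\<in>{..<m} - {s, t}. r i * c (f i)) + (r s * c (f s) + r t * c (f t))" for f
      using st by (subst sum.subset_diff[of "{s, t}"]) auto
    moreover have "(\<Sum>i\<in>{..<m} - {s, t}. r i * c (?q i)) = (\<Sum>i\<in>{..<m} - {s, t}. r i * c (p i))"
      by (intro sum.cong) (auto simp: transpose_def)
    ultimately have "?w p < ?w ?q" using st by simp
    then show ?thesis using q by blast
  qed
  have fin: "finite ?P" by (simp add: finite_permutations)
  moreover have "?P \<noteq> {}" using permutes_id by blast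
  ultimately have "Max (?w ` ?P) \<in> ?w ` ?P" by (intro Max_in) auto
  then obtain q where "q \<in> ?P" "Max (?w ` ?P) = ?w q" by blast
  then have q: "q \<in> ?P" "\<forall>p\<in>?P. ?w p \<le> ?w q"
    using Max_ge[of "?w ` ?P"] fin by auto
  then have "q = id" using improve[of q] by (meson leD)
  moreover obtain p' where "p' \<in> ?P" "?w p < ?w p'" using improve[of p] p \<open>p \<noteq> id\<close> by blast
  ultimately have "?w p < ?w id" using q(2) by (meson less_le_trans)
  then show ?thesis by simp
qed

text \<open>
  Powers \<open>q ^ (i * j)\<close> make the diagonal term dominate every minor, by the rearrangement inequality.
\<close>

definition staircase :: "(nat \<Rightarrow> nat) \<Rightarrow> (nat \<Rightarrow> nat) \<Rightarrow> nat \<Rightarrow> nat \<Rightarrow> nat \<Rightarrow> real" where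
  "staircase lo hi q i j = (if lo i \<le> j \<and> j \<le> hi i then real q ^ (i * j) else 0)"

text \<open>
  If the diagonal lies in the support, then its term exceeds the sum of all the others once \<open>q\<close>
  is at least the number of permutations.  If it leaves the support at some place, then a block of
  zeros reaches from there to a corner, and it is so large that every permutation meets it.
\<close>

lemma staircase_minor:
  assumes r: "\<And>s t. s < t \<Longrightarrow> t < m \<Longrightarrow> r s < r t" and c: "\<And>s t. s < t \<Longrightarrow> t < m \<Longrightarrow> c s < c t"
    and lo: "\<And>s t. s \<le> t \<Longrightarrow> t < m \<Longrightarrow> lo (r s) \<le> lo (r t)"
    and hi: "\<And>s t. s \<le> t \<Longrightarrow> t < m \<Longrightarrow> hi (r s) \<le> hi (r t)"
    and q: "fact m \<le> q"
  defines "D \<equiv> fdet m (\<lambda>s t. staircase lo hi q (r s) (c t))"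
  shows "0 \<le> D" and "D \<noteq> 0 \<longleftrightarrow> (\<forall>t<m. lo (r t) \<le> c t \<and> c t \<le> hi (r t))"
proof -
  let ?P = "{p. p permutes {..<m}}"
  let ?S = "\<lambda>s t. staircase lo hi q (r s) (c t)"
  let ?w = "\<lambda>p. \<Sum>t<m. r t * c (p t)"
  have q1: "1 \<le> real q" using q fact_ge_1[of m, where 'a = nat] by linarith
  have prod_bound: "\<bar>signof p * (\<Prod>t<m. ?S t (p t))\<bar> \<le> real q ^ ?w p" for p
  proof -
    have "\<bar>\<Prod>t<m. ?S t (p t)\<bar> \<le> (\<Prod>t<m. real q ^ (r t * c (p t)))"
      unfolding abs_prod by (rule prod_mono) (auto simp: staircase_def)
    then show ?thesis by (simp add: power_sum abs_mult sign_def)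
  qed
  have pos: "0 < D" if diag: "\<forall>t<m. lo (r t) \<le> c t \<and> c t \<le> hi (r t)"
  proof -
    let ?W = "\<Sum>t<m. r t * c t"
    have "D = real q ^ ?W + (\<Sum>p\<in>?P - {id}. signof p * (\<Prod>t<m. ?S t (p t)))"
      unfolding D_def fdet_expand
      by (subst sum.remove[of _ id]) (use diag in \<open>auto simp: finite_permutations permutes_id staircase_def power_sum\<close>)
    moreover have "\<bar>\<Sum>p\<in>?P - {id}. signof p * (\<Prod>t<m. ?S t (p t))\<bar> < real q ^ ?W"
    proof (cases "?P - {id} = {}")
      case True
      then show ?thesis using q1 by (simp only: True) simp
    next
      case False
      then obtain p0 where "p0 \<in> ?P" "p0 \<noteq> id" by blast
      then have W: "0 < ?W" using rearrangement_strict[of m r c p0] r c by fastforce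
      have "\<bar>\<Sum>p\<in>?P - {id}. signof p * (\<Prod>t<m. ?S t (p t))\<bar> \<le> (\<Sum>p\<in>?P - {id}. real q ^ (?W - 1))"
      proof (rule order.trans[OF sum_abs], rule sum_mono)
        fix p assume "p \<in> ?P - {id}"
        then have "?w p \<le> ?W - 1" using rearrangement_strict[of m r c p] r c by fastforce
        then show "\<bar>signof p * (\<Prod>t<m. ?S t (p t))\<bar> \<le> real q ^ (?W - 1)"
          using prod_bound[of p] power_increasing[OF _ q1] by (meson order.trans)
      qed
      also have "\<dots> = (fact m - 1) * real q ^ (?W - 1)"
        by (simp add: finite_permutations permutes_id card_permutations of_nat_diff)
      also have "\<dots> < real q * real q ^ (?W - 1)"
      proof (rule mult_strict_right_mono)
        have "real (fact m) \<le> real q" using q by (simp only: of_nat_le_iff)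
        then show "fact m - 1 < real q" by simp
      qed (use q1 in simp)
      also have "\<dots> = real q ^ ?W" using W by (cases ?W) auto
      finally show ?thesis .
    qed
    ultimately show ?thesis by linarith
  qed
  have zero: "D = 0" if nd: "\<not> (\<forall>t<m. lo (r t) \<le> c t \<and> c t \<le> hi (r t))"
  proof -
    have vanish: "(\<Prod>t<m. ?S t (p t)) = 0" if p: "p permutes {..<m}" for p
    proof -
      obtain t where t: "t < m" "c t < lo (r t) \<or> hi (r t) < c t" using nd by force
      have "\<exists>s<m. ?S s (p s) = 0"
      proof (cases "c t < lo (r t)")
        case True
        \<comment> \<open>Rows from \<open>t\<close> on vanish in columns up to \<open>t\<close>: too few columns remain for them.\<close>
        have "\<exists>s<m. t \<le> s \<and> p s \<le> t"
        proof (rule ccontr)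
          assume "\<not> ?thesis"
          then have "p ` {t..<m} \<subseteq> {Suc t..<m}" using permutes_in_image[OF p] by (force simp: not_le)
          then have "card {t..<m} \<le> card {Suc t..<m}"
            using permutes_inj_on[OF p] card_inj_on_le by blast
          then show False using t by simp
        qed
        then obtain s where s: "s < m" "t \<le> s" "p s \<le> t" by blast
        then have "c (p s) \<le> c t" using c[of "p s" t] t by (cases "p s = t") auto
        then have "c (p s) < lo (r s)" using True lo[of t s] s by linarith
        then show ?thesis using s by (auto simp: staircase_def)
      next
        case False
        have "\<exists>s<m. s \<le> t \<and> t \<le> p s"
        proof (rule ccontr)
          assume "\<not> ?thesis"
          then have "p s < t" if "s \<le> t" for s using that t(1) by (meson le_less_trans not_le)
          then have "p ` {..t} \<subseteq> {..<t}" by auto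
          then have "card {..t} \<le> card {..<t}"
            using permutes_inj_on[OF p] card_inj_on_le by blast
          then show False by simp
        qed
        then obtain s where s: "s < m" "s \<le> t" "t \<le> p s" by blast
        have "p s < m" using permutes_in_image[OF p, of s] s by simp
        then have "c t \<le> c (p s)" using c[of t "p s"] s by (cases "p s = t") auto
        then have "hi (r s) < c (p s)" using False t hi[of s t] s by linarith
        then show ?thesis using s by (auto simp: staircase_def)
      qed
      then show ?thesis by (intro prod_zero) auto
    qed
    show ?thesis unfolding D_def fdet_expand by (intro sum.neutral) (use vanish in auto)
  qed
  show "0 \<le> D" using pos zero by (cases "\<forall>t<m. lo (r t) \<le> c t \<and> c t \<le> hi (r t)") auto
  show "D \<noteq> 0 \<longleftrightarrow> (\<forall>t<m. lo (r t) \<le> c t \<and> c t \<le> hi (r t))" using pos zero by fastforce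
qed

text \<open>
  Unit vectors for the columns outside \<open>P\<close> complete \<open>X\<close> to an invertible matrix, and the sign of its
  determinant can be chosen as long as there is a row to be negated.
\<close>

lemma extend_to_positive_det:
  assumes "m \<le> K" and P: "P \<subseteq> {..<K}" "card P = m"
    and pos: "0 < fdet m (\<lambda>i t. X i (nth_smallest P t))"
  shows "\<exists>Z. (\<forall>i<m. Z i = X i) \<and> 0 < fdet K Z"
proof -
  let ?C = "{..<K} - P"
  have fin: "finite P" "finite ?C" using P finite_subset by blast+
  have cC: "card ?C = K - m" using P fin by (simp add: card_Diff_subset)
  define Z where "Z i = (if i < m then X i else (\<lambda>j. if j = nth_smallest ?C (i - m) then 1 else 0))" for i
  have "fdet K Z \<noteq> 0"
  proof
    assume "fdet K Z = 0"
    then obtain x where x: "\<exists>j<K. x j \<noteq> 0" "\<And>i. i < K \<Longrightarrow> (\<Sum>j<K. Z i j * x j) = 0"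
      unfolding fdet_kernel by blast
    have offP: "x j = 0" if j: "j \<in> ?C" for j
    proof -
      obtain t where t: "t < K - m" "j = nth_smallest ?C t"
        using j nth_smallest_image[OF fin(2)] cC by (metis imageE lessThan_iff)
      have "(\<Sum>j'<K. Z (m + t) j' * x j') = (\<Sum>j'<K. if j' = j then x j' else 0)"
        by (intro sum.cong) (auto simp: Z_def t)
      then show ?thesis using x(2)[of "m + t"] t(1) j by simp
    qed
    have "(\<Sum>t<m. X i (nth_smallest P t) * x (nth_smallest P t)) = 0" if i: "i < m" for i
    proof -
      have "(\<Sum>t<m. X i (nth_smallest P t) * x (nth_smallest P t)) = (\<Sum>j\<in>P. X i j * x j)"
        using sum.reindex[OF nth_smallest_inj[OF fin(1)], of "\<lambda>j. X i j * x j"]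
          nth_smallest_image[OF fin(1)] P(2) by simp
      also have "\<dots> = (\<Sum>j<K. Z i j * x j)"
        by (rule sum.mono_neutral_cong_left) (use P offP i in \<open>auto simp: Z_def\<close>)
      finally show ?thesis using x(2)[of i] i assms(1) by simp
    qed
    then have "x (nth_smallest P t) = 0" if "t < m" for t
      using pos that fdet_kernel[of m "\<lambda>i t. X i (nth_smallest P t)"] by (auto dest!: spec[of _ "\<lambda>t. x (nth_smallest P t)"])
    then have "x j = 0" if "j \<in> P" for j
      using that nth_smallest_image[OF fin(1)] P(2) by (metis imageE lessThan_iff)
    then show False using x(1) offP by blast
  qed
  moreover have "\<forall>i<m. Z i = X i" by (simp add: Z_def)
  moreover have "\<exists>Z'. (\<forall>i<m. Z' i = X i) \<and> 0 < fdet K Z'" if neg: "fdet K Z < 0"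
  proof -
    \<comment> \<open>For \<open>m = K\<close> no row is added, but then the determinant is the given minor.\<close>
    have "m \<noteq> K"
    proof
      assume mK: "m = K"
      then have "P = {..<K}" using P by (simp add: card_subset_eq)
      then have "nth_smallest P t = t" if "t < K" for t
        using nth_smallest_unique[of K "\<lambda>i. i" t] that by simp
      then have "fdet K (\<lambda>i t. X i (nth_smallest P t)) = fdet K Z"
        by (intro fdet_cong) (simp add: Z_def mK)
      then show False using pos neg mK by simp
    qed
    then have "m < K" using assms(1) by simp
    then have "0 < fdet K (\<lambda>i j. if i = K - 1 then - Z i j else Z i j)"
      using fdet_negate_row[of "K - 1" K Z] neg by simp
    moreover have "\<forall>i<m. (\<lambda>j. if i = K - 1 then - Z i j else Z i j) = X i"
      using \<open>m < K\<close> by (auto simp: Z_def)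
    ultimately show ?thesis by (intro exI[of _ "\<lambda>i j. if i = K - 1 then - Z i j else Z i j"]) simp
  qed
  ultimately show ?thesis by (metis linorder_neqE_linordered_idom)
qed

section \<open>Realizable quotients are quotients\<close>

text \<open>
  A row combination \<open>w\<close> of the matrix is a functional on its columns.  In this dual view,
  restricting to the top rows just means using fewer functionals, so that linear relations among columns
  persist.
\<close>

definition pairing :: "nat \<Rightarrow> (nat \<Rightarrow> nat \<Rightarrow> real) \<Rightarrow> (nat \<Rightarrow> real) \<Rightarrow> nat \<Rightarrow> real" where
  "pairing k A w e = (\<Sum>r<k. w r * A r e)"

definition col_basis :: "nat \<Rightarrow> (nat \<Rightarrow> nat \<Rightarrow> real) \<Rightarrow> nat set \<Rightarrow> bool" where
  "col_basis k A D \<longleftrightarrow> finite D \<and> card D = k \<and> fdet k (\<lambda>i j. A i (nth_smallest D j)) \<noteq> 0"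

lemma col_basis_functional_zero:
  assumes "col_basis k A D" "\<And>d. d \<in> D \<Longrightarrow> pairing k A w d = 0" "r < k" shows "w r = 0"
proof -
  have "fdet k (\<lambda>i j. A j (nth_smallest D i)) \<noteq> 0"
    using assms(1) fdet_transpose[of k "\<lambda>i j. A i (nth_smallest D j)"] by (simp add: col_basis_def)
  moreover have "(\<Sum>j<k. A j (nth_smallest D i) * w j) = 0" if "i < k" for i
    using assms(2)[of "nth_smallest D i"] nth_smallest_in[of D i] assms(1) that
    by (simp add: pairing_def col_basis_def mult.commute)
  ultimately show ?thesis
    using fdet_kernel[of k "\<lambda>i j. A j (nth_smallest D i)"] assms(3) by blast
qed

lemma col_basisI:
  assumes "finite D" "card D = k"
    and "\<And>w. (\<And>d. d \<in> D \<Longrightarrow> pairing k A w d = 0) \<Longrightarrow> \<forall>r<k. w r = 0"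
  shows "col_basis k A D"
proof (rule ccontr)
  assume "\<not> col_basis k A D"
  then have "fdet k (\<lambda>i j. A j (nth_smallest D i)) = 0"
    using assms(1,2) fdet_transpose[of k "\<lambda>i j. A i (nth_smallest D j)"] by (simp add: col_basis_def)
  then obtain x where x: "\<exists>j<k. x j \<noteq> 0" "\<forall>i<k. (\<Sum>j<k. A j (nth_smallest D i) * x j) = 0"
    unfolding fdet_kernel by blast
  have "pairing k A x d = 0" if d: "d \<in> D" for d
  proof -
    obtain i where "i < k" "d = nth_smallest D i"
      using d nth_smallest_image[OF assms(1)] assms(2) by (metis imageE lessThan_iff)
    then show ?thesis using x(2) by (simp add: pairing_def mult.commute)
  qed
  then show False using assms(3) x(1) by blast
qed

lemma col_basis_interpolate:
  assumes "col_basis k A D" shows "\<exists>w. \<forall>d\<in>D. pairing k A w d = g d"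
proof -
  have "fdet k (\<lambda>i j. A j (nth_smallest D i)) \<noteq> 0"
    using assms fdet_transpose[of k "\<lambda>i j. A i (nth_smallest D j)"] by (simp add: col_basis_def)
  then obtain x where x: "\<forall>i<k. (\<Sum>j<k. A j (nth_smallest D i) * x j) = g (nth_smallest D i)"
    using fdet_solve[of k "\<lambda>i j. A j (nth_smallest D i)" "\<lambda>i. g (nth_smallest D i)"] by blast
  have "pairing k A x d = g d" if d: "d \<in> D" for d
  proof -
    obtain i where "i < k" "d = nth_smallest D i"
      using d nth_smallest_image[of D] assms unfolding col_basis_def by (metis imageE lessThan_iff)
    then show ?thesis using x by (simp add: pairing_def mult.commute)
  qed
  then show ?thesis by blast
qed

lemma pairing_diff: "pairing k A (\<lambda>r. v r - u r) e = pairing k A v e - pairing k A u e"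
  by (simp add: pairing_def left_diff_distrib sum_subtractf)

lemma pairing_scale: "pairing k A (\<lambda>r. c * v r) e = c * pairing k A v e"
  by (simp add: pairing_def sum_distrib_left mult.assoc)

lemma pairing_sum: "pairing k A (\<lambda>r. \<Sum>b\<in>B. g b r) e = (\<Sum>b\<in>B. pairing k A (g b) e)"
  unfolding pairing_def sum_distrib_right by (rule sum.swap)

lemma pairing_zero: "(\<And>r. r < k \<Longrightarrow> v r = 0) \<Longrightarrow> pairing k A v e = 0"
  by (simp add: pairing_def)

text \<open>
  The functionals that vanish on \<open>D - {p}\<close> are the multiples of the dual functional \<open>w\<close>.
\<close>

lemma col_basis_exchange_iff:
  assumes D: "col_basis k A D" and p: "p \<in> D" and s: "s \<notin> D - {p}"
    and w: "\<And>d. d \<in> D \<Longrightarrow> pairing k A w d = (if d = p then 1 else 0)"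
  shows "col_basis k A (insert s (D - {p})) \<longleftrightarrow> pairing k A w s \<noteq> 0"
proof
  assume b: "col_basis k A (insert s (D - {p}))"
  show "pairing k A w s \<noteq> 0"
  proof
    assume "pairing k A w s = 0"
    then have "\<And>d. d \<in> insert s (D - {p}) \<Longrightarrow> pairing k A w d = 0" using w by auto
    then have "pairing k A w p = 0"
      using col_basis_functional_zero[OF b] by (intro pairing_zero) blast
    then show False using w[OF p] by simp
  qed
next
  assume nz: "pairing k A w s \<noteq> 0"
  show "col_basis k A (insert s (D - {p}))"
  proof (rule col_basisI)
    show "finite (insert s (D - {p}))" using D by (simp add: col_basis_def)
    show "card (insert s (D - {p})) = k"
      using D s p by (simp add: col_basis_def card.insert_remove) (metis card_gt_0_iff empty_iff Suc_pred)
    fix v assume v: "\<And>d. d \<in> insert s (D - {p}) \<Longrightarrow> pairing k A v d = 0"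
    let ?c = "pairing k A v p"
    have eq: "v r - ?c * w r = 0" if "r < k" for r
    proof (rule col_basis_functional_zero[OF D _ that])
      fix d assume "d \<in> D"
      then show "pairing k A (\<lambda>r. v r - ?c * w r) d = 0"
        using v w by (cases "d = p") (auto simp: pairing_diff pairing_scale)
    qed
    have "pairing k A (\<lambda>r. v r - ?c * w r) s = 0" by (intro pairing_zero eq)
    then have "?c = 0" using v nz by (simp add: pairing_diff pairing_scale)
    then show "\<forall>r<k. v r = 0" using eq by simp
  qed
qed

text \<open>
  A column that is a combination of the columns in \<open>S\<close> can be replaced by one of them.
\<close>

lemma col_basis_exchange:
  assumes D: "col_basis k A D" and p: "p \<in> D"
    and rel: "\<And>v. pairing k A v p = (\<Sum>s\<in>S. c s * pairing k A v s)"
  shows "\<exists>s\<in>S. s \<notin> D - {p} \<and> col_basis k A (insert s (D - {p}))"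
proof -
  obtain w where w: "\<And>d. d \<in> D \<Longrightarrow> pairing k A w d = (if d = p then 1 else 0)"
    using col_basis_interpolate[OF D, of "\<lambda>d. if d = p then 1 else 0"] by blast
  have "(\<Sum>s\<in>S. c s * pairing k A w s) \<noteq> 0" using rel[of w] w[OF p] by simp
  then obtain s where s: "s \<in> S" "pairing k A w s \<noteq> 0" by (metis (no_types, lifting) mult_zero_right sum.neutral)
  have "s \<notin> D - {p}" using w[of s] s(2) by (auto split: if_splits)
  then show ?thesis using col_basis_exchange_iff[OF D p _ w] s by blast
qed

text \<open>
  Column \<open>e\<close> is expressed in the basis \<open>B\<close>; tested against all functionals, this is the expansion of
  \<open>v\<close> in the dual basis.
\<close>

lemma col_basis_expansion:
  assumes B: "col_basis k A B"
    and w: "\<And>b d. b \<in> B \<Longrightarrow> d \<in> B \<Longrightarrow> pairing k A (w b) d = (if d = b then 1 else 0)"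
  shows "pairing k A v e = (\<Sum>b\<in>B. pairing k A (w b) e * pairing k A v b)"
proof -
  let ?u = "\<lambda>r. \<Sum>b\<in>B. pairing k A v b * w b r"
  have u: "pairing k A ?u e = (\<Sum>b\<in>B. pairing k A v b * pairing k A (w b) e)" for e
    by (simp add: pairing_sum pairing_scale)
  have "pairing k A (\<lambda>r. v r - ?u r) e = 0"
  proof (rule pairing_zero, rule col_basis_functional_zero[OF B])
    fix d assume d: "d \<in> B"
    have "pairing k A ?u d = (\<Sum>b\<in>B. if b = d then pairing k A v b else 0)"
      unfolding u by (intro sum.cong) (use w d in auto)
    then show "pairing k A (\<lambda>r. v r - ?u r) d = 0"
      using d B by (simp add: pairing_diff col_basis_def)
  qed
  then show ?thesis unfolding pairing_diff u by (simp add: mult.commute)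
qed

lemma pairing_restrict:
  assumes "k' \<le> k" shows "pairing k' A v e = pairing k A (\<lambda>r. if r < k' then v r else 0) e"
  unfolding pairing_def by (rule sum.mono_neutral_cong_left) (use assms in auto)

text \<open>
  Let \<open>S\<close> be the set of columns in the unique expression of column \<open>p\<close> in the basis \<open>B\<close>.  The
  same expression holds for the top rows.  Among the bases for the top rows that lie in \<open>B\<close>, one that
  meets \<open>S\<close> as much as possible works: if \<open>p\<close> could replace an element outside \<open>S\<close>, then so could some
  element of \<open>S\<close>, contrary to the choice.
\<close>

lemma top_rows_quotient:
  assumes le: "k' \<le> k" and B: "col_basis k A B" and p: "p \<notin> B"
    and D0: "col_basis k' A D0"
  shows "\<exists>D\<subseteq>B. col_basis k' A D \<and>
    (\<forall>q\<in>D. col_basis k' A (insert p (D - {q})) \<longrightarrow> col_basis k A (insert p (B - {q})))"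
proof -
  have fB: "finite B" using B by (simp add: col_basis_def)
  have "\<forall>b\<in>B. \<exists>w. \<forall>d\<in>B. pairing k A w d = (if d = b then 1 else 0)"
    using col_basis_interpolate[OF B, of "\<lambda>d. if d = _ then 1 else 0"] by blast
  then obtain w where w: "\<And>b d. b \<in> B \<Longrightarrow> d \<in> B \<Longrightarrow> pairing k A (w b) d = (if d = b then 1 else 0)"
    by metis
  have rel: "pairing k' A v e = (\<Sum>b\<in>B. pairing k A (w b) e * pairing k' A v b)" for v e
    unfolding pairing_restrict[OF le, of A v] by (rule col_basis_expansion[OF B w])
  \<comment> \<open>Similarly, a basis for the top rows that meets \<open>B\<close> as much as possible lies in \<open>B\<close>.\<close>
  have inside: "\<exists>D. col_basis k' A D \<and> D \<subseteq> B"
  proof -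
    have "\<exists>D. col_basis k' A D \<and> (\<forall>D'. col_basis k' A D' \<longrightarrow> card (D' \<inter> B) \<le> card (D \<inter> B))"
      by (rule ex_has_greatest_nat[of _ D0 _ "Suc (card B)"])
        (use D0 fB in \<open>auto simp: less_Suc_eq_le card_mono\<close>)
    then obtain D where D: "col_basis k' A D" "\<And>D'. col_basis k' A D' \<Longrightarrow> card (D' \<inter> B) \<le> card (D \<inter> B)"
      by blast
    have "D \<subseteq> B"
    proof
      fix q assume q: "q \<in> D"
      show "q \<in> B"
      proof (rule ccontr)
        assume qB: "q \<notin> B"
        obtain s where s: "s \<in> B" "s \<notin> D - {q}" "col_basis k' A (insert s (D - {q}))"
          using col_basis_exchange[OF D(1) q rel] by blast
        have "insert s (D - {q}) \<inter> B = insert s (D \<inter> B)" "s \<notin> D \<inter> B" using s qB by auto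
        then show False using D(2)[OF s(3)] fB by simp
      qed
    qed
    then show ?thesis using D(1) by blast
  qed
  define S where "S = {b \<in> B. pairing k A (w b) p \<noteq> 0}"
  have "\<exists>D. (col_basis k' A D \<and> D \<subseteq> B) \<and>
      (\<forall>D'. col_basis k' A D' \<and> D' \<subseteq> B \<longrightarrow> card (D' \<inter> S) \<le> card (D \<inter> S))"
  proof -
    obtain D1 where "col_basis k' A D1 \<and> D1 \<subseteq> B" using inside by blast
    then show ?thesis
      by (rule ex_has_greatest_nat[of _ D1 _ "Suc (card S)"])
        (use fB in \<open>auto simp: less_Suc_eq_le card_mono S_def\<close>)
  qed
  then obtain D where D: "col_basis k' A D" "D \<subseteq> B"
    and max: "\<And>D'. col_basis k' A D' \<Longrightarrow> D' \<subseteq> B \<Longrightarrow> card (D' \<inter> S) \<le> card (D \<inter> S)" by blast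
  have relS: "pairing k' A v p = (\<Sum>b\<in>S. pairing k A (w b) p * pairing k' A v b)" for v
    unfolding rel[of v p] S_def by (rule sum.mono_neutral_right) (use fB in auto)
  have "col_basis k A (insert p (B - {q}))" if q: "q \<in> D" "col_basis k' A (insert p (D - {q}))" for q
  proof -
    have "q \<in> S"
    proof (rule ccontr)
      assume qS: "q \<notin> S"
      have pD: "insert p (D - {q}) - {p} = D - {q}" using p D(2) by auto
      obtain s where s: "s \<in> S" "s \<notin> D - {q}" "col_basis k' A (insert s (D - {q}))"
        using col_basis_exchange[OF q(2) _ relS] unfolding pD by blast
      have "insert s (D - {q}) \<inter> S = insert s (D \<inter> S)" "s \<notin> D \<inter> S" using s qS by auto
      moreover have "insert s (D - {q}) \<subseteq> B" using s D(2) by (auto simp: S_def)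
      moreover have "finite S" using fB by (simp add: S_def)
      ultimately show False using max[OF s(3)] by simp
    qed
    then show ?thesis
      using col_basis_exchange_iff[OF B, of q p "w q"] w p by (auto simp: S_def)
  qed
  then show ?thesis using D by blast
qed

lemma maximal_minor_nonzero_iff:
  assumes "M \<in> carrier_mat k n" "B \<in> ksubsets n k"
  shows "maximal_minor M B \<noteq> 0 \<longleftrightarrow> col_basis k (\<lambda>r e. M $$ (r, e - 1)) B"
  using maximal_minor_eq_fdet[OF assms] assms(2) finite_subset[of B "{1..n}"]
  by (simp add: col_basis_def ksubsets_def)

lemma pick_lessThan: "i < k \<Longrightarrow> pick {..<k} i = i"
  using pick_card_in_set[of i "{..<k}"] by (simp add: Collect_conj_eq lessThan_def[symmetric] Int_absorb1)

lemma top_rows: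
  assumes "M \<in> carrier_mat l n" "k \<le> l"
  shows "submatrix M {..<k} UNIV \<in> carrier_mat k n"
    and "i < k \<Longrightarrow> j < n \<Longrightarrow> submatrix M {..<k} UNIV $$ (i, j) = M $$ (i, j)"
proof -
  have "{i. i < l \<and> i \<in> {..<k}} = {..<k}" using assms(2) by auto
  then have c: "card {i. i < dim_row M \<and> i \<in> {..<k}} = k" using assms(1) by simp
  then show "submatrix M {..<k} UNIV \<in> carrier_mat k n"
    using assms(1) by (intro carrier_matI) (simp_all add: dim_submatrix)
  show "submatrix M {..<k} UNIV $$ (i, j) = M $$ (i, j)" if "i < k" "j < n"
    using submatrix_index[of i M "{..<k}" j UNIV] c that assms(1) by (simp add: pick_lessThan pick_UNIV)
qed

theorem realizable_imp_quotient:
  assumes "realizable_quotient n \<B>' \<B>" and "\<B>' \<noteq> {}"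
  shows "matroid_quotient n \<B>' \<B>"
proof -
  obtain k l M where kl: "k \<le> l" and M: "represents l n M \<B>"
    and M': "represents k n (submatrix M {..<k} UNIV) \<B>'"
    using assms(1) unfolding realizable_quotient_def by blast
  let ?A = "\<lambda>r e. M $$ (r, e - 1)"
  have carr: "M \<in> carrier_mat l n" using M by (simp add: represents_def full_rank_mats_def)
  have bases: "B \<in> \<B> \<longleftrightarrow> B \<subseteq> {1..n} \<and> col_basis l ?A B" for B
    using M maximal_minor_nonzero_iff[OF carr, of B]
    by (auto simp: represents_def ksubsets_def col_basis_def)
  have bases': "B \<in> \<B>' \<longleftrightarrow> B \<subseteq> {1..n} \<and> col_basis k ?A B" for B
  proof (cases "B \<in> ksubsets n k")
    case True
    have e: "nth_smallest B j - 1 < n" if "j < k" for j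
      using nth_smallest_in[of B j] True finite_subset[of B "{1..n}"] that by (force simp: ksubsets_def)
    have "B \<in> \<B>' \<longleftrightarrow> maximal_minor (submatrix M {..<k} UNIV) B \<noteq> 0"
      using M' True by (simp add: represents_def)
    also have "maximal_minor (submatrix M {..<k} UNIV) B = fdet k (\<lambda>i j. M $$ (i, nth_smallest B j - 1))"
      unfolding maximal_minor_eq_fdet[OF top_rows(1)[OF carr kl] True]
      by (rule fdet_cong) (use top_rows(2)[OF carr kl] e in simp)
    finally show ?thesis
      using True finite_subset[of B "{1..n}"] by (simp add: col_basis_def ksubsets_def)
  qed (use M' in \<open>auto simp: represents_def ksubsets_def col_basis_def\<close>)
  show ?thesis unfolding matroid_quotient_def
  proof (intro ballI)
    fix B p assume B: "B \<in> \<B>" and p: "p \<in> {1..n} - B"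
    obtain D0 where "D0 \<in> \<B>'" using assms(2) by blast
    then have "col_basis k ?A D0" "col_basis l ?A B" "B \<subseteq> {1..n}" using bases bases' B by blast+
    then obtain D where D: "D \<subseteq> B" "col_basis k ?A D"
      and ex: "\<forall>q\<in>D. col_basis k ?A (insert p (D - {q})) \<longrightarrow> col_basis l ?A (insert p (B - {q}))"
      using top_rows_quotient[OF kl, of ?A B p D0] p by blast
    have upd: "(X \<union> {p}) - {q} = insert p (X - {q})" if "q \<in> X" "X \<subseteq> B" for X q using that p by auto
    have "(B \<union> {p}) - {q} \<in> \<B>" if q: "q \<in> D" "(D \<union> {p}) - {q} \<in> \<B>'" for q
    proof -
      have "col_basis k ?A (insert p (D - {q}))"
        using q(2) bases'[of "insert p (D - {q})"] upd[OF q(1) D(1)] by simp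
      then have "col_basis l ?A (insert p (B - {q}))" using ex q(1) by blast
      moreover have "insert p (B - {q}) \<subseteq> {1..n}" using p \<open>B \<subseteq> {1..n}\<close> by auto
      ultimately show ?thesis using bases[of "insert p (B - {q})"] upd[of q B] q(1) D(1) by auto
    qed
    moreover have "D \<in> \<B>'" using D B bases bases' by blast
    ultimately show "\<exists>B'\<in>\<B>'. B' \<subseteq> B \<and> (\<forall>q\<in>B'. (B' \<union> {p}) - {q} \<in> \<B>' \<longrightarrow> (B \<union> {p}) - {q} \<in> \<B>)"
      using D by blast
  qed
qed

section \<open>Lattice path matroids and basis exchange\<close>

locale lattice_path =
  fixes n k :: nat and U L :: "nat set"
  assumes U: "U \<in> ksubsets n k" and L: "L \<in> ksubsets n k" and gale: "gale_le U L"
    and clean: "loopless_coloopless n (lpm n k U L)"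
begin

lemma U_sub: "U \<subseteq> {1..n}" and L_sub: "L \<subseteq> {1..n}"
  and card_U: "card U = k" and card_L: "card L = k"
  and fin_U: "finite U" and fin_L: "finite L"
  using U L finite_subset[of _ "{1..n}"] by (auto simp: ksubsets_def)

lemma cnt_L_le_U: "cnt L y \<le> cnt U y"
  using gale gale_le_iff_cnt[OF U_sub L_sub] card_U card_L by simp

lemmas basis_iff = mem_lpm_iff_cnt[OF U L]

lemma basis_sub: "B \<in> lpm n k U L \<Longrightarrow> B \<subseteq> {1..n} \<and> finite B \<and> card B = k"
  using finite_subset[of B "{1..n}"] by (simp add: lpm_def ksubsets_def)

lemma basisD:
  assumes "B \<in> lpm n k U L" shows "cnt L y \<le> cnt B y" "cnt B y \<le> cnt U y"
  using assms basis_iff by auto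

lemma basisI:
  assumes sub: "B \<subseteq> {1..n}" and n: "cnt B n = k"
    and le: "\<And>y. y \<le> n \<Longrightarrow> cnt L y \<le> cnt B y \<and> cnt B y \<le> cnt U y"
  shows "B \<in> lpm n k U L"
proof -
  have card: "card B = k" using n cnt_top[OF sub] by simp
  have "cnt L y \<le> cnt B y \<and> cnt B y \<le> cnt U y" for y
    using le[of y] cnt_top[OF sub, of y] cnt_top[OF U_sub, of y] cnt_top[OF L_sub, of y] card card_U card_L
    by (cases "y \<le> n") auto
  then show ?thesis unfolding basis_iff using sub card by (simp add: ksubsets_def)
qed

lemma U_basis: "U \<in> lpm n k U L"
  unfolding basis_iff using U cnt_L_le_U by simp

lemma avoiding_basis: "x \<in> {1..n} \<Longrightarrow> \<exists>B\<in>lpm n k U L. x \<notin> B"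
  using clean unfolding loopless_coloopless_def coloop_def by blast

lemma cnt_L_le_U_pred:
  assumes "x \<in> {1..n}" shows "cnt L x \<le> cnt U (x - 1)"
proof -
  obtain B where "B \<in> lpm n k U L" "x \<notin> B" using avoiding_basis assms by blast
  then show ?thesis using basisD[of B x] basisD[of B "x - 1"] cnt_eq_pred[of x B] by simp
qed

text \<open>
  An element common to both ends of a row would lie in all bases.
\<close>

lemma row_strict:
  assumes "i < k" shows "nth_smallest U i < nth_smallest L i"
proof -
  have m: "nth_smallest L i \<in> L" using nth_smallest_in[OF fin_L] card_L assms by simp
  then have "Suc i \<le> cnt U (nth_smallest L i - 1)"
    using cnt_L_le_U_pred[of "nth_smallest L i"] L_sub cnt_nth_smallest[OF fin_L, of i] card_L assms by auto
  then have "nth_smallest U i \<le> nth_smallest L i - 1"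
    using nth_smallest_le_iff[OF fin_U] card_U assms by simp
  then show ?thesis using m L_sub by force
qed

lemma card_gaps: "card ({1..n} - U) = n - k" "card ({1..n} - L) = n - k"
  using U_sub L_sub card_U card_L fin_U fin_L by (simp_all add: card_Diff_subset)

lemma column_le:
  assumes "j < n - k" shows "nth_smallest ({1..n} - L) j \<le> nth_smallest ({1..n} - U) j"
proof -
  let ?b = "nth_smallest ({1..n} - U) j"
  have b: "?b \<in> {1..n} - U" using nth_smallest_in[of "{1..n} - U" j] card_gaps assms by simp
  have "cnt ({1..n} - U) ?b = Suc j" using cnt_nth_smallest[of "{1..n} - U" j] card_gaps assms by simp
  then have "j < cnt ({1..n} - L) ?b"
    using cnt_compl[OF U_sub, of ?b] cnt_compl[OF L_sub, of ?b] cnt_L_le_U[of ?b] b by auto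
  then show ?thesis using nth_smallest_le_iff[of "{1..n} - L" j] card_gaps assms by simp
qed

lemma column_intervals_eq:
  "column_intervals n U L = {{nth_smallest ({1..n} - L) j..nth_smallest ({1..n} - U) j} |j. j < n - k}"
  unfolding column_intervals_def card_gaps by simp

lemma row_intervals_eq:
  "row_intervals n U L = {{nth_smallest L i..n} \<union> {1..nth_smallest U i} |i. i < k}"
  unfolding row_intervals_def card_U by simp

text \<open>
  The four conditions \<open>a \<le> l\<close>, \<open>l \<le> x\<close>, \<open>x \<le> u\<close>, \<open>u \<le> b\<close> on the ends \<open>l\<close>, \<open>u\<close> of the \<open>j\<close>-th column
  interval bound \<open>j\<close> from below by two counts of non-elements and from above by two others; the four
  inequalities compare these lower bounds with these upper bounds.
\<close>

lemma column_interval_exists: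
  assumes a: "0 < a" "a \<le> x" "x \<le> b" "b \<le> n"
    and h1: "cnt L x \<le> cnt U (x - 1)"
    and h2: "cnt U b + x \<le> cnt U (x - 1) + b"
    and h3: "cnt L x + a \<le> cnt L (a - 1) + x"
    and h4: "cnt U b + a \<le> cnt L (a - 1) + b"
  shows "\<exists>J\<in>column_intervals n U L. x \<in> J \<and> J \<subseteq> {a..b}"
proof -
  let ?U = "{1..n} - U" and ?L = "{1..n} - L"
  have c: "cnt ?U (x - 1) = x - 1 - cnt U (x - 1)" "cnt ?U b = b - cnt U b"
    "cnt ?L (a - 1) = a - 1 - cnt L (a - 1)" "cnt ?L x = x - cnt L x"
    using cnt_compl[OF U_sub] cnt_compl[OF L_sub] a by simp_all
  have le: "cnt U (x - 1) \<le> x - 1" "cnt L (a - 1) \<le> a - 1" "cnt U b \<le> b" "cnt L x \<le> x"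
    using cnt_le[OF U_sub] cnt_le[OF L_sub] by blast+
  define j where "j = max (cnt ?U (x - 1)) (cnt ?L (a - 1))"
  have j: "cnt ?U (x - 1) \<le> j" "cnt ?L (a - 1) \<le> j" "j < cnt ?U b" "j < cnt ?L x"
  proof -
    have "cnt ?U (x - 1) < cnt ?U b" unfolding c using h2 le(1,3) a by linarith
    moreover have "cnt ?U (x - 1) < cnt ?L x" unfolding c using h1 le(1,4) a by linarith
    moreover have "cnt ?L (a - 1) < cnt ?U b" unfolding c using h4 le(2,3) a by linarith
    moreover have "cnt ?L (a - 1) < cnt ?L x" unfolding c using h3 le(2,4) a by linarith
    ultimately show "cnt ?U (x - 1) \<le> j" "cnt ?L (a - 1) \<le> j" "j < cnt ?U b" "j < cnt ?L x"
      unfolding j_def by simp_all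
  qed
  have jk: "j < n - k" using j(3) cnt_le_card[of ?U b] card_gaps by simp
  have iffU: "nth_smallest ?U j \<le> y \<longleftrightarrow> j < cnt ?U y" and iffL: "nth_smallest ?L j \<le> y \<longleftrightarrow> j < cnt ?L y" for y
    using nth_smallest_le_iff[of ?U j y] nth_smallest_le_iff[of ?L j y] card_gaps jk by simp_all
  have "\<not> nth_smallest ?U j \<le> x - 1" "\<not> nth_smallest ?L j \<le> a - 1"
    "nth_smallest ?U j \<le> b" "nth_smallest ?L j \<le> x"
    using j unfolding iffU iffL by simp_all
  then have "x \<in> {nth_smallest ?L j..nth_smallest ?U j}" "{nth_smallest ?L j..nth_smallest ?U j} \<subseteq> {a..b}"
    using a by auto
  then show ?thesis unfolding column_intervals_eq using jk by blast
qed

text \<open>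
  In terms of lattice paths: the path of \<open>B\<close> touches the lower boundary before step \<open>a\<close> and the upper
  boundary after step \<open>b\<close>.  This and the next two lemmas show that it is exactly such contacts
  that confine the exchanges with \<open>x\<close>.
\<close>

lemma column_interval_at_basis:
  assumes B: "B \<in> lpm n k U L" "x \<notin> B" and a: "0 < a" "a \<le> x" "x \<le> b" "b \<le> n"
    and tight: "cnt B (a - 1) = cnt L (a - 1)" "cnt B b = cnt U b"
  shows "\<exists>J\<in>column_intervals n U L. x \<in> J \<and> J \<subseteq> {a..b}"
proof (rule column_interval_exists[OF a])
  have fB: "finite B" using B basis_sub by blast
  have pred: "cnt B x = cnt B (x - 1)" using cnt_eq_pred B by simp
  show "cnt L x \<le> cnt U (x - 1)" using basisD[OF B(1)] pred by (metis le_trans)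
  show "cnt U b + x \<le> cnt U (x - 1) + b"
    using cnt_diff_less[OF fB B(2), of "x - 1" b] basisD(2)[OF B(1), of "x - 1"] tight a by linarith
  show "cnt L x + a \<le> cnt L (a - 1) + x"
    using cnt_diff_less[OF fB B(2), of "a - 1" x] basisD(1)[OF B(1), of x] tight a by linarith
  show "cnt U b + a \<le> cnt L (a - 1) + b"
    using cnt_diff_less[OF fB B(2), of "a - 1" b] tight a by linarith
qed

text \<open>
  Exchanging an element below \<open>a\<close> would lower the count at \<open>a - 1\<close>, where it is already minimal;
  exchanging one above \<open>b\<close> would raise the count at \<open>b\<close>, where it is already maximal.
\<close>

lemma exchange_confined:
  assumes B: "B \<in> lpm n k U L" "x \<notin> B" and x: "a \<le> x" "x \<le> b" and a: "0 < a"
    and tight: "cnt B (a - 1) = cnt L (a - 1)" "cnt B b = cnt U b"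
    and q: "q \<in> B" "insert x (B - {q}) \<in> lpm n k U L"
  shows "q \<in> {a..b}"
proof (rule ccontr)
  assume out: "q \<notin> {a..b}"
  have fB: "finite B" using B basis_sub by blast
  note swap = cnt_swap[OF fB q(1) B(2)]
  show False
  proof (cases "q < a")
    case True
    then have "q \<le> a - 1" "\<not> x \<le> a - 1" using x a by auto
    then show False using swap[of "a - 1"] basisD(1)[OF q(2), of "a - 1"] tight by simp
  next
    case False
    then have "\<not> q \<le> b" using out by auto
    then show False using swap[of b] basisD(2)[OF q(2), of b] tight x by simp
  qed
qed

text \<open>
  The largest element \<open>q\<close> of \<open>B\<close> below \<open>a\<close> cannot be exchanged with \<open>x\<close>.  The exchange lowers the count by
  one between \<open>q\<close> and \<open>x\<close>, so the count must be minimal somewhere there; if this happens before \<open>a - 1\<close>, then it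
  is minimal at \<open>a - 1\<close> too, because \<open>B\<close> has no element in between.  Beyond \<open>b\<close> the argument is the same.
\<close>

lemma tight_if_exchange_confined:
  assumes B: "B \<in> lpm n k U L" "x \<notin> B" and x: "a \<le> x" "x \<le> b" "0 < a" "b \<le> n"
    and conf: "\<And>q. q \<in> B \<Longrightarrow> insert x (B - {q}) \<in> lpm n k U L \<Longrightarrow> q \<in> {a..b}"
  shows "\<exists>y\<ge>a - 1. y < x \<and> cnt B y = cnt L y" "\<exists>z\<le>b. x \<le> z \<and> cnt B z = cnt U z"
proof -
  have fB: "finite B" and subB: "B \<subseteq> {1..n}" and cardB: "card B = k" using basis_sub[OF B(1)] by auto
  have violated: "\<exists>y. cnt (insert x (B - {q})) y < cnt L y \<or> cnt U y < cnt (insert x (B - {q})) y"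
    if q: "q \<in> B" "q \<notin> {a..b}" for q
  proof (rule ccontr)
    assume "\<not> ?thesis"
    moreover have "card (insert x (B - {q})) = k"
      using card_Suc_Diff1[OF fB q(1)] B(2) fB cardB by simp
    then have "insert x (B - {q}) \<in> ksubsets n k" using subB x by (auto simp: ksubsets_def)
    ultimately show False using conf[OF q(1)] q(2) unfolding basis_iff by (simp add: not_less)
  qed
  show "\<exists>y\<ge>a - 1. y < x \<and> cnt B y = cnt L y"
  proof (cases "B \<inter> {..<a} = {}")
    case True
    then have "B \<inter> {..a - 1} = {}" using x by auto
    then have "cnt B (a - 1) = 0" by (simp add: cnt_def)
    then show ?thesis using basisD(1)[OF B(1), of "a - 1"] x by (intro exI[of _ "a - 1"]) auto
  next
    case False
    define q where "q = Max (B \<inter> {..<a})"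
    have q: "q \<in> B" "q < a" and qmax: "\<And>b. b \<in> B \<Longrightarrow> b < a \<Longrightarrow> b \<le> q"
      using Max_in[of "B \<inter> {..<a}"] Max_ge[of "B \<inter> {..<a}"] False fB by (auto simp: q_def)
    obtain y where y: "cnt (insert x (B - {q})) y < cnt L y \<or> cnt U y < cnt (insert x (B - {q})) y"
      using violated[OF q(1)] q(2) by auto
    have y': "q \<le> y" "y < x" "cnt B y = cnt L y"
      using y cnt_swap[OF fB q(1) B(2), of y] basisD[OF B(1), of y] q(2) x by (auto split: if_splits)
    show ?thesis
    proof (cases "a - 1 \<le> y")
      case True
      then show ?thesis using y' by blast
    next
      case False
      have "B \<inter> {y<..a - 1} = {}" using qmax y' x(3) by force
      then have "cnt B (a - 1) = cnt B y" using cnt_diff[OF fB, of y "a - 1"] False by simp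
      moreover have "cnt L y \<le> cnt L (a - 1)" using cnt_mono[OF fin_L] False by simp
      ultimately have "cnt B (a - 1) = cnt L (a - 1)"
        using y' basisD(1)[OF B(1), of "a - 1"] by simp
      then show ?thesis using x by (intro exI[of _ "a - 1"]) auto
    qed
  qed
  show "\<exists>z\<le>b. x \<le> z \<and> cnt B z = cnt U z"
  proof (cases "B \<inter> {b<..} = {}")
    case True
    then have "B \<inter> {..b} = B" by auto
    then have "cnt B b = k" using cardB by (simp add: cnt_def)
    then show ?thesis using basisD(2)[OF B(1), of b] cnt_le_card[OF fin_U, of b] card_U x
      by (intro exI[of _ b]) auto
  next
    case False
    define q where "q = Min (B \<inter> {b<..})"
    have q: "q \<in> B" "b < q" and qmin: "\<And>c. c \<in> B \<Longrightarrow> b < c \<Longrightarrow> q \<le> c"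
      using Min_in[of "B \<inter> {b<..}"] Min_le[of "B \<inter> {b<..}"] False fB by (auto simp: q_def)
    obtain z where z: "cnt (insert x (B - {q})) z < cnt L z \<or> cnt U z < cnt (insert x (B - {q})) z"
      using violated[OF q(1)] q(2) by auto
    have z': "z < q" "x \<le> z" "cnt B z = cnt U z"
      using z cnt_swap[OF fB q(1) B(2), of z] basisD[OF B(1), of z] q(2) x by (auto split: if_splits)
    show ?thesis
    proof (cases "z \<le> b")
      case True
      then show ?thesis using z' by blast
    next
      case False
      have "B \<inter> {b<..z} = {}" using qmin z' by force
      then have "cnt B z = cnt B b" using cnt_diff[OF fB, of b z] False by simp
      moreover have "cnt U b \<le> cnt U z" using cnt_mono[OF fin_U] False by simp
      ultimately have "cnt B b = cnt U b"
        using z' basisD(2)[OF B(1), of b] by simp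
      then show ?thesis using x by (intro exI[of _ b]) auto
    qed
  qed
qed

text \<open>
  The basis follows \<open>L\<close> up to \<open>a\<close>, contains all of \<open>{a..b}\<close> but \<open>x\<close>, and follows \<open>U\<close> after \<open>b\<close>: the column
  interval is the fundamental circuit of \<open>x\<close>.
\<close>

lemma column_basis:
  assumes j: "j < n - k" and ab: "a = nth_smallest ({1..n} - L) j" "b = nth_smallest ({1..n} - U) j"
    and x: "a \<le> x" "x \<le> b"
  shows "\<exists>B\<in>lpm n k U L. x \<notin> B \<and> cnt B (a - 1) = cnt L (a - 1) \<and> cnt B b = cnt U b"
proof -
  let ?U = "{1..n} - U" and ?L = "{1..n} - L"
  have aL: "a \<in> ?L" and bU: "b \<in> ?U"
    using nth_smallest_in[of ?U j] nth_smallest_in[of ?L j] card_gaps j ab by simp_all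
  have "cnt ?U b = Suc j" "cnt ?L (a - 1) = j"
    using cnt_nth_smallest[of ?U j] cnt_nth_smallest_pred[of ?L n j] card_gaps j ab by simp_all
  moreover have "b \<le> n" "a - 1 \<le> n" using aL bU by auto
  ultimately have cb: "b = cnt U b + Suc j" and ca: "a - 1 = cnt L (a - 1) + j"
    using cnt_compl[OF U_sub, of b] cnt_compl[OF L_sub, of "a - 1"] cnt_le[OF L_sub, of "a - 1"]
    by linarith+
  have ab_eq: "cnt L (a - 1) + (b - a) = cnt U b" using ca cb aL x by auto
  define B where "B = (L \<inter> {..a - 1}) \<union> (({a..b} - {x}) \<union> (U \<inter> {b<..}))"
  have c: "cnt B y = cnt L (min y (a - 1)) + ((min y b + 1 - a) - (if x \<le> y then 1 else 0) +
      (cnt U y - cnt U (min y b)))" for y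
  proof -
    have "cnt B y = cnt (L \<inter> {..a - 1}) y + cnt (({a..b} - {x}) \<union> (U \<inter> {b<..})) y"
      unfolding B_def by (rule cnt_union) (use fin_L fin_U x aL in auto)
    also have "cnt (({a..b} - {x}) \<union> (U \<inter> {b<..})) y = cnt ({a..b} - {x}) y + cnt (U \<inter> {b<..}) y"
      by (rule cnt_union) (use fin_U in auto)
    finally show ?thesis
      using cnt_below[of L "a - 1" y] cnt_above[OF fin_U, of b y] cnt_remove[of "{a..b}" x y] x aL
      by (simp add: cnt_atLeastAtMost)
  qed
  have "B \<in> lpm n k U L"
  proof (rule basisI)
    show "B \<subseteq> {1..n}" using U_sub L_sub aL bU unfolding B_def by auto
    have "min n (a - 1) = a - 1" "min n b = b" "x \<le> n" "0 < a" using aL bU x by auto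
    moreover have "cnt U b \<le> k" "cnt U n = k" using cnt_le_card[OF fin_U] cnt_top[OF U_sub] card_U by simp_all
    moreover have "b + 1 - a - 1 = b - a" using x by simp
    ultimately show "cnt B n = k" using c[of n] ab_eq x by simp
    fix y assume "y \<le> n"
    consider "y < a" | "a \<le> y" "y \<le> b" | "b < y" by linarith
    then show "cnt L y \<le> cnt B y \<and> cnt B y \<le> cnt U y"
    proof cases
      case 1
      then have "min y (a - 1) = y" "min y b = y" using x by auto
      then have "cnt B y = cnt L y" using c[of y] 1 x by simp
      then show ?thesis using cnt_L_le_U by simp
    next
      case 2
      then have "min y (a - 1) = a - 1" "min y b = y" by auto
      then have cB: "cnt B y = cnt L (a - 1) + ((y + 1 - a) - (if x \<le> y then 1 else 0))"
        using c[of y] by simp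
      have "cnt L y \<le> cnt L a + (y - a)" using cnt_diff_le[OF fin_L] 2 by simp
      moreover have "cnt L a = cnt L (a - 1)" using cnt_eq_pred aL by blast
      ultimately have low: "cnt L y \<le> cnt B y" using cB 2 by auto
      have "cnt U b \<le> cnt U y + (b - y)" using cnt_diff_le[OF fin_U] 2 by simp
      moreover have "cnt U b < cnt U y + (b - y)" if "y < b"
        using cnt_diff_less[OF fin_U _ that, of b] bU by simp
      moreover have "y < b" if "y < x" using that x by simp
      ultimately have "cnt B y \<le> cnt U y" using cB 2 cb ca x aL by (auto split: if_splits)
      then show ?thesis using low by simp
    next
      case 3
      have "cnt U b \<le> cnt U y" using cnt_mono[OF fin_U] 3 by simp
      moreover have "min y (a - 1) = a - 1" "min y b = b" "x \<le> y" "b + 1 - a - 1 = b - a" using 3 x by auto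
      ultimately have "cnt B y = cnt U y" using c[of y] ab_eq[symmetric] by simp
      then show ?thesis using cnt_L_le_U by simp
    qed
  qed
  moreover have "x \<notin> B" using x aL unfolding B_def by auto
  moreover have "cnt B (a - 1) = cnt L (a - 1)" using c[of "a - 1"] x aL by auto
  moreover have "cnt B b = cnt U b" 
  proof -
    have "min b (a - 1) = a - 1" "b + 1 - a - 1 = b - a" using x by auto
    then show ?thesis using c[of b] x ab_eq by simp
  qed
  ultimately show ?thesis by blast
qed

text \<open>
  The elements of \<open>U\<close> up to \<open>a\<close> and those of \<open>L\<close> from \<open>b\<close> on are one too many for a basis.  Left out is \<open>x\<close>
  itself if it is among them, and otherwise the end of the gap on the other side.  Leaving out \<open>x\<close>
  fails only if the two boundary paths meet between \<open>x\<close> and the gap; then \<open>M\<close> splits at the meeting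
  point, and the part that contains \<open>x\<close> has a column interval through \<open>x\<close>.
\<close>

lemma row_basis:
  assumes i: "i < k" and ab: "a = nth_smallest U i" "b = nth_smallest L i"
    and x: "x \<in> {b..n} \<union> {1..a}"
  shows "(\<exists>J\<in>column_intervals n U L. x \<in> J \<and> J \<subseteq> {b..n} \<union> {1..a}) \<or>
    (\<exists>B\<in>lpm n k U L. x \<notin> B \<and> B \<subseteq> {b..n} \<union> {1..a})"
proof -
  have less: "a < b" using row_strict[OF i] ab by simp
  have aU: "a \<in> U" and bL: "b \<in> L"
    using nth_smallest_in[OF fin_U] nth_smallest_in[OF fin_L] card_U card_L i ab by simp_all
  have range: "1 \<le> a" "b \<le> n" using aU bL U_sub L_sub by auto
  have ca: "cnt U a = Suc i" "cnt U (a - 1) = i" and cb: "cnt L b = Suc i" "cnt L (b - 1) = i"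
    using cnt_nth_smallest[OF fin_U, of i] cnt_nth_smallest_pred[OF U_sub, of i]
      cnt_nth_smallest[OF fin_L, of i] cnt_nth_smallest_pred[OF L_sub, of i] card_U card_L i ab by simp_all
  have cntn: "cnt U n = k" "cnt L n = k" using cnt_top[OF U_sub] cnt_top[OF L_sub] card_U card_L by simp_all
  have x1: "x \<in> {1..n}" using x less range by auto
  have hybrid: "cnt (S \<union> T) y = cnt S y + cnt T y" if "S \<subseteq> U \<inter> {..a}" "T \<subseteq> L \<inter> {b - 1<..}" for S T y
  proof (rule cnt_union)
    show "finite S" "finite T" using that fin_U fin_L finite_subset by blast+
    show "S \<inter> T = {}" using that less by force
  qed
  have sub: "S \<union> T \<subseteq> {b..n} \<union> {1..a}" "S \<union> T \<subseteq> {1..n}"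
    if "S \<subseteq> U \<inter> {..a}" "T \<subseteq> L \<inter> {b - 1<..}" for S T
    using that U_sub L_sub less by force+
  have bounds: "y < b \<Longrightarrow> cnt L y \<le> i" "a \<le> y \<Longrightarrow> Suc i \<le> cnt U y" for y
    using cnt_mono[OF fin_L, of y "b - 1"] cnt_mono[OF fin_U, of a y] cb ca by auto
  have witness: ?thesis if "B \<in> lpm n k U L" "B \<subseteq> {b..n} \<union> {1..a}" "x \<notin> B" for B
    using that by blast
  have dich: "(\<forall>y\<in>Y. cnt L y < cnt U y) \<or> (\<exists>y\<in>Y. cnt L y = cnt U y)" for Y
    using cnt_L_le_U by (meson le_neq_implies_less)
  have "x \<le> a \<or> b \<le> x" using x by auto
  then consider "x \<le> a" "x \<notin> U" | "x \<le> a" "x \<in> U" "\<forall>y\<in>{x..a}. cnt L y < cnt U y"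
    | "x \<le> a" "x \<in> U" "\<exists>y\<in>{x..a}. cnt L y = cnt U y"
    | "b \<le> x" "x \<notin> L" | "b \<le> x" "x \<in> L" "\<forall>y\<in>{b..x - 1}. cnt L y < cnt U y"
    | "b \<le> x" "x \<in> L" "\<exists>y\<in>{b..x - 1}. cnt L y = cnt U y"
    using dich[of "{x..a}"] dich[of "{b..x - 1}"] by blast
  then show ?thesis
  proof cases
    case 1
    let ?B = "(U \<inter> {..a}) \<union> (L \<inter> {b<..})"
    have c: "cnt ?B y = cnt U (min y a) + (cnt L y - cnt L (min y b))" for y
    proof -
      have "L \<inter> {b<..} \<subseteq> L \<inter> {b - 1<..}" by auto
      from hybrid[OF order_refl this] show ?thesis by (simp only: cnt_below cnt_above[OF fin_L])
    qed
    have "?B \<in> lpm n k U L"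
    proof (rule basisI)
      show "?B \<subseteq> {1..n}" by (rule sub) auto
      have "min n a = a" "min n b = b" using range less by auto
      then show "cnt ?B n = k" using c[of n] ca cb cntn i by simp
      fix y
      consider "y \<le> a" | "a < y" "y < b" | "b \<le> y" by linarith
      then show "cnt L y \<le> cnt ?B y \<and> cnt ?B y \<le> cnt U y"
      proof cases
        case 1
        then have "min y a = y" "min y b = y" using less by auto
        then show ?thesis using c[of y] cnt_L_le_U[of y] by simp
      next
        case 2
        then have "min y a = a" "min y b = y" by auto
        then show ?thesis using c[of y] 2 ca bounds[of y] by simp
      next
        case 3
        then have "Suc i \<le> cnt L y" using cnt_mono[OF fin_L, of b y] cb by simp
        moreover have "min y a = a" "min y b = b" using 3 less by auto
        ultimately show ?thesis using c[of y] ca cb cnt_L_le_U[of y] by simp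
      qed
    qed
    moreover have "?B \<subseteq> {b..n} \<union> {1..a}" by (rule sub) auto
    moreover have "x \<notin> ?B" using 1 less by auto
    ultimately show ?thesis by (rule witness)
  next
    case 2
    let ?B = "(U \<inter> {..a} - {x}) \<union> (L \<inter> {b - 1<..})"
    have c: "cnt ?B y = cnt U (min y a) - (if x \<le> y then 1 else 0) + (cnt L y - cnt L (min y (b - 1)))" for y
    proof -
      have "x \<in> U \<inter> {..a}" using 2 by auto
      then show ?thesis
        using hybrid[of "U \<inter> {..a} - {x}" "L \<inter> {b - 1<..}" y] fin_U
        by (simp only: cnt_below cnt_above[OF fin_L] cnt_remove finite_Int Diff_subset order_refl simp_thms)
    qed
    have "?B \<in> lpm n k U L"
    proof (rule basisI)
      show "?B \<subseteq> {1..n}" by (rule sub) auto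
      have "min n a = a" "min n (b - 1) = b - 1" "x \<le> n" using range less x1 by auto
      then show "cnt ?B n = k" using c[of n] ca cb cntn i by simp
      fix y
      consider "y \<le> a" | "a < y" "y < b" | "b \<le> y" by linarith
      then show "cnt L y \<le> cnt ?B y \<and> cnt ?B y \<le> cnt U y"
      proof cases
        case 1
        then have "min y a = y" "min y (b - 1) = y" using less by auto
        moreover have "cnt L y < cnt U y" if "x \<le> y" using 2 1 that by simp
        ultimately show ?thesis using c[of y] cnt_L_le_U[of y] by (cases "x \<le> y") simp_all
      next
        case 2
        then have "min y a = a" "min y (b - 1) = y" "x \<le> y" using \<open>x \<le> a\<close> by auto
        then show ?thesis using c[of y] 2 ca bounds[of y] by simp
      next
        case 3
        then have "i \<le> cnt L y" using cnt_mono[OF fin_L, of b y] cb by simp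
        moreover have "min y a = a" "min y (b - 1) = b - 1" "x \<le> y" using 2 3 less by auto
        ultimately show ?thesis using c[of y] ca cb cnt_L_le_U[of y] by simp
      qed
    qed
    moreover have "?B \<subseteq> {b..n} \<union> {1..a}" by (rule sub) auto
    moreover have "x \<notin> ?B" using 2 less by auto
    ultimately show ?thesis by (rule witness)
  next
    case 3
    then obtain y where y: "x \<le> y" "y \<le> a" "cnt L y = cnt U y" by auto
    have pred: "cnt L x \<le> cnt U (x - 1)" by (rule cnt_L_le_U_pred[OF x1])
    have step: "cnt L y \<le> cnt L x + (y - x)" using cnt_diff_le[OF fin_L y(1)] .
    have small: "cnt U (x - 1) \<le> x - 1" by (rule cnt_le[OF U_sub])
    have ineqs: "cnt U y + x \<le> cnt U (x - 1) + y" "cnt L x + 1 \<le> x" "cnt U y + 1 \<le> y" "y \<le> n"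
      using step pred small y x1 range less by auto
    obtain J where J: "J \<in> column_intervals n U L" "x \<in> J" "J \<subseteq> {1..y}"
      using column_interval_exists[of 1 x y]
        x1 y pred ineqs cnt_zero[OF L_sub] by auto
    moreover have "{1..y} \<subseteq> {b..n} \<union> {1..a}" using y by auto
    ultimately show ?thesis by blast
  next
    case 4
    let ?B = "(U \<inter> {..a - 1}) \<union> (L \<inter> {b - 1<..})"
    have c: "cnt ?B y = cnt U (min y (a - 1)) + (cnt L y - cnt L (min y (b - 1)))" for y
    proof -
      have "U \<inter> {..a - 1} \<subseteq> U \<inter> {..a}" by auto
      from hybrid[OF this order_refl] show ?thesis by (simp only: cnt_below cnt_above[OF fin_L])
    qed
    have "?B \<in> lpm n k U L"
    proof (rule basisI)
      show "?B \<subseteq> {1..n}" by (rule sub) auto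
      have "min n (a - 1) = a - 1" "min n (b - 1) = b - 1" using range less by auto
      then show "cnt ?B n = k" using c[of n] ca cb cntn i by simp
      fix y
      consider "y < a" | "a \<le> y" "y < b" | "b \<le> y" by linarith
      then show "cnt L y \<le> cnt ?B y \<and> cnt ?B y \<le> cnt U y"
      proof cases
        case 2
        then have "min y (a - 1) = a - 1" "min y (b - 1) = y" by auto
        then show ?thesis using c[of y] 2 ca bounds[of y] by simp
      next
        case 3
        then have "i \<le> cnt L y" using cnt_mono[OF fin_L, of b y] cb by simp
        moreover have "min y (a - 1) = a - 1" "min y (b - 1) = b - 1" using 3 less by auto
        ultimately show ?thesis using c[of y] 3 less ca cb cnt_L_le_U[of y] by simp
      next
        case 1
        then have "min y (a - 1) = y" "min y (b - 1) = y" using less by auto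
        then show ?thesis using c[of y] cnt_L_le_U[of y] by simp
      qed
    qed
    moreover have "?B \<subseteq> {b..n} \<union> {1..a}" by (rule sub) auto
    moreover have "x \<notin> ?B" using 4 less by auto
    ultimately show ?thesis by (rule witness)
  next
    case 5
    let ?B = "(U \<inter> {..a}) \<union> (L \<inter> {b - 1<..} - {x})"
    have c: "cnt ?B y = cnt U (min y a) + (cnt L y - cnt L (min y (b - 1)) - (if x \<le> y then 1 else 0))" for y
    proof -
      have "x \<in> L \<inter> {b - 1<..}" using 5 less by auto
      then show ?thesis
        using hybrid[of "U \<inter> {..a}" "L \<inter> {b - 1<..} - {x}" y] fin_L
        by (simp only: cnt_below cnt_above[OF fin_L] cnt_remove finite_Int Diff_subset order_refl simp_thms)
    qed
    have "?B \<in> lpm n k U L"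
    proof (rule basisI)
      show "?B \<subseteq> {1..n}" by (rule sub) auto
      have "min n a = a" "min n (b - 1) = b - 1" "x \<le> n" using range less x1 by auto
      then show "cnt ?B n = k" using c[of n] ca cb cntn i by simp
      fix y
      consider "y \<le> a" | "a < y" "y < b" | "b \<le> y" by linarith
      then show "cnt L y \<le> cnt ?B y \<and> cnt ?B y \<le> cnt U y"
      proof cases
        case 1
        then have "min y a = y" "min y (b - 1) = y" "\<not> x \<le> y" using less 5 by auto
        then show ?thesis using c[of y] cnt_L_le_U[of y] by simp
      next
        case 2
        then have "min y a = a" "min y (b - 1) = y" "\<not> x \<le> y" using 5 by auto
        then show ?thesis using c[of y] 2 ca bounds[of y] by simp
      next
        case 3
        then have "Suc i \<le> cnt L y" using cnt_mono[OF fin_L, of b y] cb by simp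
        moreover have "min y a = a" "min y (b - 1) = b - 1" using 3 less by auto
        moreover have "cnt L y < cnt U y" if "y < x" using 5 3 that by simp
        ultimately show ?thesis using c[of y] ca cb cnt_L_le_U[of y] by (cases "x \<le> y") simp_all
      qed
    qed
    moreover have "?B \<subseteq> {b..n} \<union> {1..a}" by (rule sub) auto
    moreover have "x \<notin> ?B" using 5 less by auto
    ultimately show ?thesis by (rule witness)
  next
    case 6
    then obtain y where "y \<in> {b..x - 1}" "cnt L y = cnt U y" by blast
    then have y: "b \<le> y" "y < x" "cnt L y = cnt U y" using less by auto
    have pred: "cnt L x \<le> cnt U (x - 1)" by (rule cnt_L_le_U_pred[OF x1])
    have step: "cnt U (x - 1) \<le> cnt U y + (x - 1 - y)" using cnt_diff_le[OF fin_U, of y "x - 1"] y by simp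
    have top: "cnt L n \<le> cnt L x + (n - x)" using cnt_diff_le[OF fin_L, of x n] x1 by simp
    have "cnt L x \<le> cnt U y + (x - 1 - y)" "k \<le> cnt U y + (x - 1 - y) + (n - x)"
      using pred step top cntn by linarith+
    then have "cnt U n + x \<le> cnt U (x - 1) + n" "cnt L x + Suc y \<le> cnt L y + x"
      "cnt U n + Suc y \<le> cnt L y + n"
      using pred top cntn x1 y by auto
    then obtain J where J: "J \<in> column_intervals n U L" "x \<in> J" "J \<subseteq> {Suc y..n}"
      using column_interval_exists[of "Suc y" x n] x1 y pred by auto
    moreover have "{Suc y..n} \<subseteq> {b..n} \<union> {1..a}" using y by auto
    ultimately show ?thesis by blast
  qed
qed

text \<open>
  Let \<open>x \<le> a\<close>.  If the count of \<open>B\<close> is maximal at \<open>a\<close>, then \<open>{1..a}\<close> contains a column interval around \<open>x\<close>.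
  Otherwise the last row of \<open>U\<close> that begins in \<open>{1..a}\<close> ends at \<open>b\<close> or later, because \<open>B\<close> jumps from \<open>a\<close> to
  \<open>b\<close>; its row interval contains \<open>x\<close> unless \<open>U\<close> has no element in \<open>{x..a}\<close>, and in that case there is
  again a column interval.
\<close>

lemma row_cover:
  assumes B: "B \<in> lpm n k U L" "x \<notin> B" "B \<subseteq> {b..n} \<union> {1..a}" and x: "x \<in> {b..n} \<union> {1..a}"
    and ab: "1 \<le> a" "a < b" "b \<le> n"
  shows "\<exists>J\<in>lpm_intervals n U L. x \<in> J \<and> J \<subseteq> {b..n} \<union> {1..a}"
proof -
  have fB: "finite B" and cardB: "card B = k" using basis_sub[OF B(1)] by auto
  have "B \<inter> {a<..b - 1} = {}" using B(3) ab by force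
  then have gap: "cnt B (b - 1) = cnt B a" using cnt_diff[OF fB, of a "b - 1"] ab by simp
  have pred: "cnt B x = cnt B (x - 1)" using cnt_eq_pred B(2) by blast
  have h1: "cnt L x \<le> cnt U (x - 1)" using basisD(1)[OF B(1), of x] basisD(2)[OF B(1), of "x - 1"] pred by simp
  have cntn: "cnt U n = k" "cnt L n = k" "cnt B n = k"
    using cnt_top[OF U_sub] cnt_top[OF L_sub] cnt_top[of B n n] basis_sub[OF B(1)] card_U card_L by auto
  have row: ?thesis if i: "i < k" "nth_smallest U i \<le> a" "b \<le> nth_smallest L i"
    "x \<le> nth_smallest U i \<or> nth_smallest L i \<le> x" for i
  proof -
    have "{nth_smallest L i..n} \<union> {1..nth_smallest U i} \<in> lpm_intervals n U L"
      unfolding lpm_intervals_def row_intervals_eq using i(1) by blast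
    moreover have "x \<in> {nth_smallest L i..n} \<union> {1..nth_smallest U i}" using i x ab by auto
    moreover have "{nth_smallest L i..n} \<union> {1..nth_smallest U i} \<subseteq> {b..n} \<union> {1..a}" using i by auto
    ultimately show ?thesis by blast
  qed
  have iffU: "nth_smallest U i \<le> y \<longleftrightarrow> i < cnt U y" and iffL: "nth_smallest L i \<le> y \<longleftrightarrow> i < cnt L y" if "i < k" for i y
    using nth_smallest_le_iff[OF fin_U] nth_smallest_le_iff[OF fin_L] card_U card_L that by simp_all
  show ?thesis
  proof (cases "x \<le> a")
    case True
    then have x1: "1 \<le> x" using x ab by auto
    have column: ?thesis if "\<exists>J\<in>column_intervals n U L. x \<in> J \<and> J \<subseteq> {1..a}"
      using that unfolding lpm_intervals_def by blast
    show ?thesis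
    proof (cases "cnt B a < cnt U a \<and> cnt U (x - 1) < cnt U a")
      case rows: True
      let ?i = "cnt U a - 1"
      have i: "?i < k" using rows cnt_le_card[OF fin_U, of a] card_U by linarith
      have "cnt L (b - 1) \<le> cnt B a" using basisD(1)[OF B(1), of "b - 1"] gap by simp
      then have "\<not> nth_smallest L ?i \<le> b - 1" "nth_smallest U ?i \<le> a" "\<not> nth_smallest U ?i \<le> x - 1"
        unfolding iffU[OF i] iffL[OF i] using rows by auto
      then show ?thesis by (intro row[OF i]) auto
    next
      case False
      show ?thesis
      proof (cases "cnt B a = cnt U a")
        case True
        show ?thesis
          by (rule column, rule column_interval_at_basis[OF B(1,2)])
            (use x1 \<open>x \<le> a\<close> True ab cnt_zero[OF L_sub] cnt_zero[of B n] basis_sub[OF B(1)] in auto)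
      next
        case neq: False
        have le: "cnt U a \<le> cnt U (x - 1)" using False neq basisD(2)[OF B(1), of a] by linarith
        have "cnt U (x - 1) \<le> x - 1" by (rule cnt_le[OF U_sub])
        then show ?thesis
          by (intro column column_interval_exists)
            (use x1 True ab h1 le cnt_zero[OF L_sub] in auto)
      qed
    qed
  next
    case False
    then have xb: "b \<le> x" "x \<le> n" using x by auto
    have column: ?thesis if "\<exists>J\<in>column_intervals n U L. x \<in> J \<and> J \<subseteq> {b..n}"
      using that unfolding lpm_intervals_def by blast
    show ?thesis
    proof (cases "cnt L (b - 1) < cnt B (b - 1) \<and> cnt L (b - 1) < cnt L x")
      case rows: True
      let ?i = "cnt L (b - 1)"
      have i: "?i < k" using rows cnt_le_card[OF fin_L, of x] card_L by simp
      have "cnt B (b - 1) \<le> cnt U a" using basisD(2)[OF B(1), of a] gap by simp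
      then have "\<not> nth_smallest L ?i \<le> b - 1" "nth_smallest U ?i \<le> a" "nth_smallest L ?i \<le> x"
        unfolding iffU[OF i] iffL[OF i] using rows by auto
      then show ?thesis by (intro row[OF i]) auto
    next
      case False
      show ?thesis
      proof (cases "cnt L (b - 1) = cnt B (b - 1)")
        case True
        show ?thesis
          by (rule column, rule column_interval_at_basis[OF B(1,2)]) (use xb True ab cntn in auto)
      next
        case neq: False
        have le: "cnt L x \<le> cnt L (b - 1)" using False neq basisD(1)[OF B(1), of "b - 1"] by linarith
        have "cnt L n \<le> cnt L x + (n - x)" using cnt_diff_le[OF fin_L xb(2)] .
        moreover have "cnt B n < cnt B (x - 1) + (n - (x - 1))"
          using cnt_diff_less[OF fB B(2), of "x - 1" n] xb ab by simp
        moreover have "cnt B (x - 1) \<le> cnt U (x - 1)" using basisD(2)[OF B(1)] .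
        ultimately show ?thesis
          by (intro column column_interval_exists) (use xb ab h1 le cntn in auto)
      qed
    qed
  qed
qed

end

section \<open>Quotients yield covers by intervals\<close>

text \<open>
  A basis of \<open>M\<close> that avoids \<open>x\<close> and whose exchanges with \<open>x\<close> stay in a column interval has a subset that
  is a basis of \<open>M'\<close> with the same property, and its contacts with the boundary of \<open>M'\<close> give an interval.  For
  row intervals containment of the basis is inherited instead.
\<close>

theorem quotient_imp_intervals:
  assumes M': "lattice_path n k' U' L'" and M: "lattice_path n k U L"
    and quot: "matroid_quotient n (lpm n k' U' L') (lpm n k U L)"
    and I: "I \<in> lpm_intervals n U L"
  shows "\<exists>\<J>\<subseteq>lpm_intervals n U' L'. I = \<Union>\<J>"
proof -
  interpret M': lattice_path n k' U' L' by (rule M')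
  interpret M: lattice_path n k U L by (rule M)
  have quotD: "\<exists>B'\<in>lpm n k' U' L'. B' \<subseteq> B \<and> (\<forall>q\<in>B'. insert x (B' - {q}) \<in> lpm n k' U' L' \<longrightarrow> insert x (B - {q}) \<in> lpm n k U L)"
    if "B \<in> lpm n k U L" "x \<in> {1..n}" "x \<notin> B" for B x
  proof -
    have "\<exists>B'\<in>lpm n k' U' L'. B' \<subseteq> B \<and>
        (\<forall>q\<in>B'. (B' \<union> {x}) - {q} \<in> lpm n k' U' L' \<longrightarrow> (B \<union> {x}) - {q} \<in> lpm n k U L)"
      using quot that unfolding matroid_quotient_def by simp
    then obtain B' where B': "B' \<in> lpm n k' U' L'" "B' \<subseteq> B"
      and ex: "\<forall>q\<in>B'. (B' \<union> {x}) - {q} \<in> lpm n k' U' L' \<longrightarrow> (B \<union> {x}) - {q} \<in> lpm n k U L" by blast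
    have "(X \<union> {x}) - {q} = insert x (X - {q})" if "q \<in> B'" for X q
      using that B' \<open>x \<notin> B\<close> by auto
    then have "\<forall>q\<in>B'. insert x (B' - {q}) \<in> lpm n k' U' L' \<longrightarrow> insert x (B - {q}) \<in> lpm n k U L"
      using ex by simp
    then show ?thesis using B' by blast
  qed
  have column: "\<exists>J\<in>lpm_intervals n U' L'. x \<in> J \<and> J \<subseteq> I" if I: "I \<in> column_intervals n U L" and x: "x \<in> I" for I x
  proof -
    obtain j where j: "j < n - k" and Ij: "I = {nth_smallest ({1..n} - L) j..nth_smallest ({1..n} - U) j}"
      using I unfolding M.column_intervals_eq by blast
    define a b where ab: "a = nth_smallest ({1..n} - L) j" "b = nth_smallest ({1..n} - U) j"
    have range: "0 < a" "b \<le> n" "a \<le> x" "x \<le> b"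
      using nth_smallest_in[of "{1..n} - L" j] nth_smallest_in[of "{1..n} - U" j] M.card_gaps j x Ij ab by auto
    obtain B where B: "B \<in> lpm n k U L" "x \<notin> B" "cnt B (a - 1) = cnt L (a - 1)" "cnt B b = cnt U b"
      using M.column_basis[OF j ab range(3,4)] by blast
    obtain B' where B': "B' \<in> lpm n k' U' L'" "B' \<subseteq> B"
      and ex: "\<forall>q\<in>B'. insert x (B' - {q}) \<in> lpm n k' U' L' \<longrightarrow> insert x (B - {q}) \<in> lpm n k U L"
      using quotD[OF B(1) _ B(2)] range by auto
    have conf: "q \<in> {a..b}" if "q \<in> B'" "insert x (B' - {q}) \<in> lpm n k' U' L'" for q
      using M.exchange_confined[OF B(1,2) range(3,4,1) B(3,4)] that B' ex by blast
    have xB': "x \<notin> B'" using B B' by blast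
    obtain y z where "a - 1 \<le> y" "y < x" "cnt B' y = cnt L' y" "z \<le> b" "x \<le> z" "cnt B' z = cnt U' z"
      using M'.tight_if_exchange_confined[OF B'(1) xB' range(3,4,1,2) conf] by blast
    then obtain J where "J \<in> column_intervals n U' L'" "x \<in> J" "J \<subseteq> {Suc y..z}"
      using M'.column_interval_at_basis[OF B'(1) xB', of "Suc y" z] range by auto
    moreover from this have "J \<subseteq> I" using \<open>a - 1 \<le> y\<close> \<open>z \<le> b\<close> range Ij ab by force
    ultimately show ?thesis unfolding lpm_intervals_def by blast
  qed
  have "\<exists>J\<in>lpm_intervals n U' L'. x \<in> J \<and> J \<subseteq> I" if x: "x \<in> I" for x
  proof (cases "I \<in> column_intervals n U L")
    case True
    then show ?thesis using column x by blast
  next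
    case False
    then obtain i where i: "i < k" and Ii: "I = {nth_smallest L i..n} \<union> {1..nth_smallest U i}"
      using I unfolding lpm_intervals_def M.row_intervals_eq by blast
    define a b where ab: "a = nth_smallest U i" "b = nth_smallest L i"
    have range: "1 \<le> a" "a < b" "b \<le> n"
      using nth_smallest_in[OF M.fin_U, of i] nth_smallest_in[OF M.fin_L, of i] M.U_sub M.L_sub
        M.card_U M.card_L M.row_strict[OF i] i ab by auto
    have x': "x \<in> {b..n} \<union> {1..a}" using x Ii ab by simp
    from M.row_basis[OF i ab x'] consider
      J where "J \<in> column_intervals n U L" "x \<in> J" "J \<subseteq> {b..n} \<union> {1..a}"
      | B where "B \<in> lpm n k U L" "x \<notin> B" "B \<subseteq> {b..n} \<union> {1..a}" by blast
    then show ?thesis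
    proof cases
      case (1 J)
      then show ?thesis using column[of J x] Ii ab by blast
    next
      case (2 B)
      have "x \<in> {1..n}" using x' range by auto
      then obtain B' where B': "B' \<in> lpm n k' U' L'" "B' \<subseteq> B" using quotD[OF 2(1) _ 2(2)] by blast
      have "x \<notin> B'" using B'(2) 2(2) by blast
      moreover have "B' \<subseteq> {b..n} \<union> {1..a}" using B'(2) 2(3) by (rule order_trans)
      ultimately have "\<exists>J\<in>lpm_intervals n U' L'. x \<in> J \<and> J \<subseteq> {b..n} \<union> {1..a}"
        using M'.row_cover[OF B'(1) _ _ x' range] by blast
      then show ?thesis unfolding Ii ab .
    qed
  qed
  then have "I = \<Union>{J \<in> lpm_intervals n U' L'. J \<subseteq> I}" by blast
  then show ?thesis by (intro exI[of _ "{J \<in> lpm_intervals n U' L'. J \<subseteq> I}"] conjI) simp_all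
qed

section \<open>Covers by intervals yield nonnegative flags\<close>

context lattice_path
begin

text \<open>
  A row interval contains \<open>1\<close> and \<open>n\<close>; if it fits into \<open>{e..f}\<close>, then that is the whole ground set, where
  the first column interval starts because \<open>1\<close> lies in \<open>L\<close> only as a coloop.
\<close>

lemma interval_starting:
  assumes J: "J \<in> lpm_intervals n U L" "e \<in> J" "J \<subseteq> {e..f}" and ef: "1 \<le> e" "f \<le> n"
  shows "\<exists>j<n - k. nth_smallest ({1..n} - L) j = e \<and> nth_smallest ({1..n} - U) j \<le> f"
proof (cases "J \<in> column_intervals n U L")
  case True
  then obtain j where j: "j < n - k" "J = {nth_smallest ({1..n} - L) j..nth_smallest ({1..n} - U) j}"
    unfolding column_intervals_eq by blast
  then have "nth_smallest ({1..n} - L) j \<in> J" "nth_smallest ({1..n} - U) j \<in> J"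
    using column_le[OF j(1)] by auto
  then have "nth_smallest ({1..n} - L) j = e" "nth_smallest ({1..n} - U) j \<le> f" using J j(2) by auto
  then show ?thesis using j(1) by blast
next
  case False
  then obtain i where i: "i < k" "J = {nth_smallest L i..n} \<union> {1..nth_smallest U i}"
    using J(1) unfolding lpm_intervals_def row_intervals_eq by blast
  have U1: "nth_smallest U i \<in> U" "nth_smallest L i \<in> L"
    using nth_smallest_in[OF fin_U] nth_smallest_in[OF fin_L] card_U card_L i by simp_all
  then have "1 \<le> nth_smallest U i" "nth_smallest L i \<le> n" using U_sub L_sub by auto
  then have "1 \<in> J" "n \<in> J" using i(2) by auto
  then have e: "e = 1" "f = n" using J(3) ef by auto
  have "1 \<notin> L"
  proof
    assume "1 \<in> L"
    then obtain i' where "i' < k" "nth_smallest L i' = 1" using index_of_member[OF fin_L] card_L by blast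
    moreover from this have "nth_smallest U i' \<in> U" using nth_smallest_in[OF fin_U] card_U by simp
    ultimately show False using row_strict[of i'] U_sub by force
  qed
  moreover have "1 \<in> {1..n}" using \<open>1 \<le> nth_smallest U i\<close> U1 U_sub by auto
  ultimately have "1 \<in> {1..n} - L" by blast
  then obtain j where j: "j < n - k" "nth_smallest ({1..n} - L) j = 1"
    using index_of_member[of "{1..n} - L" 1] card_gaps by auto
  moreover have "nth_smallest ({1..n} - U) j \<in> {1..n} - U"
    using nth_smallest_in[of "{1..n} - U" j] card_gaps j by simp
  ultimately show ?thesis using e by auto
qed

lemma interval_ending:
  assumes J: "J \<in> lpm_intervals n U L" "f \<in> J" "J \<subseteq> {e..f}" and ef: "1 \<le> e" "f \<le> n"
  shows "\<exists>j<n - k. nth_smallest ({1..n} - U) j = f"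
proof (cases "J \<in> column_intervals n U L")
  case True
  then obtain j where j: "j < n - k" "J = {nth_smallest ({1..n} - L) j..nth_smallest ({1..n} - U) j}"
    unfolding column_intervals_eq by blast
  then have "nth_smallest ({1..n} - U) j \<in> J" using column_le[OF j(1)] by auto
  then have "nth_smallest ({1..n} - U) j = f" using J j(2) by auto
  then show ?thesis using j(1) by blast
next
  case False
  then obtain i where i: "i < k" "J = {nth_smallest L i..n} \<union> {1..nth_smallest U i}"
    using J(1) unfolding lpm_intervals_def row_intervals_eq by blast
  have U1: "nth_smallest U i \<in> U" "nth_smallest L i \<in> L"
    using nth_smallest_in[OF fin_U] nth_smallest_in[OF fin_L] card_U card_L i by simp_all
  then have "nth_smallest L i \<le> n" "1 \<le> n" using L_sub by auto
  then have "n \<in> J" using i(2) by auto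
  then have f: "f = n" using J(3) ef by auto
  have "n \<notin> U"
  proof
    assume "n \<in> U"
    then obtain i' where "i' < k" "nth_smallest U i' = n" using index_of_member[OF fin_U] card_U by blast
    moreover from this have "nth_smallest L i' \<in> L" using nth_smallest_in[OF fin_L] card_L by simp
    ultimately show False using row_strict[of i'] L_sub by force
  qed
  then have "n \<in> {1..n} - U" using \<open>1 \<le> n\<close> by simp
  then show ?thesis using index_of_member[of "{1..n} - U" n] card_gaps f by auto
qed

end

text \<open>
  The greedy choice: each value is the lower limit of some earlier place, raised by one in every step since.
\<close>

lemma increasing_selection:
  fixes lo hi :: "nat \<Rightarrow> nat"
  assumes room: "\<And>m i. m \<le> i \<Longrightarrow> i < K \<Longrightarrow> lo m + (i - m) \<le> hi i"
  shows "\<exists>j. (\<forall>i<K. lo i \<le> j i \<and> j i \<le> hi i) \<and> (\<forall>s t. s < t \<longrightarrow> j s < j t)"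
proof -
  define j where "j = rec_nat (lo 0) (\<lambda>i v. max (Suc v) (lo (Suc i)))"
  have j0: "j 0 = lo 0" and jS: "j (Suc i) = max (Suc (j i)) (lo (Suc i))" for i
    by (simp_all add: j_def)
  have low: "lo i \<le> j i" for i by (cases i) (simp_all add: j0 jS)
  have origin: "\<exists>m\<le>i. j i = lo m + (i - m)" for i
  proof (induction i)
    case (Suc i)
    then obtain m where m: "m \<le> i" "j i = lo m + (i - m)" by blast
    show ?case
    proof (cases "Suc (j i) \<le> lo (Suc i)")
      case True
      then show ?thesis using jS[of i] by (intro exI[of _ "Suc i"]) simp
    next
      case False
      then show ?thesis using jS[of i] m by (intro exI[of _ m]) (simp add: Suc_diff_le)
    qed
  qed (simp add: j0)
  have "j i \<le> hi i" if "i < K" for i using origin[of i] room that by auto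
  moreover have "strict_mono j" by (simp add: strict_mono_Suc_iff jS less_max_iff_disj)
  ultimately show ?thesis using low by (intro exI[of _ j]) (simp add: strict_mono_def)
qed

text \<open>
  A cover of a column interval of \<open>M\<close> by intervals of \<open>M'\<close> is used at its end points only.  An interval of \<open>M'\<close>
  inside a column interval of \<open>M\<close> is itself a column interval, or everything, and so a covering
  interval that contains an end point of the column interval has the same end point.  This embeds
  the non-elements of \<open>L\<close> into those of \<open>L'\<close> and the non-elements of \<open>U\<close> into those of \<open>U'\<close>.
\<close>

locale intervals_covered = M': lattice_path n k' U' L' + M: lattice_path n k U L
  for n k' U' L' k U L +
  assumes cover: "\<And>I. I \<in> lpm_intervals n U L \<Longrightarrow> \<exists>\<J>\<subseteq>lpm_intervals n U' L'. I = \<Union>\<J>"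
begin

lemma covering_interval:
  assumes I: "I \<in> lpm_intervals n U L" and x: "x \<in> I"
  shows "\<exists>J\<in>lpm_intervals n U' L'. x \<in> J \<and> J \<subseteq> I"
proof -
  from cover[OF I]
  obtain \<J> where JJ: "\<J> \<subseteq> lpm_intervals n U' L'" and union: "I = \<Union>\<J>" by (elim exE conjE)
  obtain J where J: "J \<in> \<J>" "x \<in> J" using x unfolding union by (rule UnionE)
  have "J \<in> lpm_intervals n U' L'" using JJ J(1) by (rule subsetD)
  moreover have "J \<subseteq> I" unfolding union using J(1) by (rule Union_upper)
  ultimately show ?thesis using J(2) by (intro bexI[of _ J] conjI)
qed

lemma column_interval:
  assumes "j < n - k"
  shows "{nth_smallest ({1..n} - L) j..nth_smallest ({1..n} - U) j} \<in> lpm_intervals n U L"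
    and "1 \<le> nth_smallest ({1..n} - L) j" and "nth_smallest ({1..n} - U) j \<le> n"
    and "nth_smallest ({1..n} - L) j \<le> nth_smallest ({1..n} - U) j"
proof -
  show "{nth_smallest ({1..n} - L) j..nth_smallest ({1..n} - U) j} \<in> lpm_intervals n U L"
    unfolding lpm_intervals_def M.column_intervals_eq using assms by blast
  have "nth_smallest ({1..n} - L) j \<in> {1..n} - L" "nth_smallest ({1..n} - U) j \<in> {1..n} - U"
    using assms nth_smallest_in[of "{1..n} - L" j] nth_smallest_in[of "{1..n} - U" j] M.card_gaps
    by simp_all
  then show "1 \<le> nth_smallest ({1..n} - L) j" "nth_smallest ({1..n} - U) j \<le> n" by simp_all
  show "nth_smallest ({1..n} - L) j \<le> nth_smallest ({1..n} - U) j" by (rule M.column_le[OF assms])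
qed

lemma same_start:
  assumes j: "j < n - k"
  shows "\<exists>j'<n - k'. nth_smallest ({1..n} - L') j' = nth_smallest ({1..n} - L) j \<and>
    nth_smallest ({1..n} - U') j' \<le> nth_smallest ({1..n} - U) j"
proof -
  let ?a = "nth_smallest ({1..n} - L) j" and ?b = "nth_smallest ({1..n} - U) j"
  obtain J where "J \<in> lpm_intervals n U' L'" "?a \<in> J" "J \<subseteq> {?a..?b}"
    using covering_interval[OF column_interval(1)[OF j], of ?a] column_interval(4)[OF j] by auto
  then show ?thesis using M'.interval_starting column_interval(2,3)[OF j] by blast
qed

lemma same_end:
  assumes j: "j < n - k"
  shows "\<exists>j'<n - k'. nth_smallest ({1..n} - U') j' = nth_smallest ({1..n} - U) j"
proof -
  let ?a = "nth_smallest ({1..n} - L) j" and ?b = "nth_smallest ({1..n} - U) j"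
  obtain J where "J \<in> lpm_intervals n U' L'" "?b \<in> J" "J \<subseteq> {?a..?b}"
    using covering_interval[OF column_interval(1)[OF j], of ?b] column_interval(4)[OF j] by auto
  then show ?thesis using M'.interval_ending column_interval(2,3)[OF j] by blast
qed

lemma L_subset: "L' \<subseteq> L"
proof
  fix x assume x: "x \<in> L'"
  show "x \<in> L"
  proof (rule ccontr)
    assume "x \<notin> L"
    then have "x \<in> {1..n} - L" using x M'.L_sub by blast
    then obtain j where "j < n - k" "nth_smallest ({1..n} - L) j = x"
      using index_of_member[of "{1..n} - L" x] M.card_gaps by auto
    then obtain j' where "j' < n - k'" "nth_smallest ({1..n} - L') j' = x" using same_start by blast
    then show False using nth_smallest_in[of "{1..n} - L'" j'] M'.card_gaps x by auto
  qed
qed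

lemma U_subset: "U' \<subseteq> U"
proof
  fix x assume x: "x \<in> U'"
  show "x \<in> U"
  proof (rule ccontr)
    assume "x \<notin> U"
    then have "x \<in> {1..n} - U" using x M'.U_sub by blast
    then obtain j where "j < n - k" "nth_smallest ({1..n} - U) j = x"
      using index_of_member[of "{1..n} - U" x] M.card_gaps by auto
    then obtain j' where "j' < n - k'" "nth_smallest ({1..n} - U') j' = x" using same_end by blast
    then show False using nth_smallest_in[of "{1..n} - U'" j'] M'.card_gaps x by auto
  qed
qed

text \<open>
  Row \<open>i\<close> of \<open>M'\<close> stretches from row \<open>p\<close> of \<open>M\<close>, where it begins, to row \<open>q\<close> of \<open>M\<close>, where it
  ends.  If \<open>q < p\<close>, then the row interval of \<open>M\<close> that starts at the \<open>i\<close>-th element of \<open>L'\<close> ends too early to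
  contain an interval of \<open>M'\<close> through its first element.
\<close>

lemma row_begins_before_it_ends:
  assumes i: "i < k'" and p: "p < k" "nth_smallest U p = nth_smallest U' i"
    and q: "q < k" "nth_smallest L q = nth_smallest L' i"
  shows "p \<le> q"
proof (rule ccontr)
  assume "\<not> p \<le> q"
  then have Uless: "nth_smallest U q < nth_smallest U' i"
    using nth_smallest_less[OF M.fin_U, of q p] p M.card_U by simp
  let ?a = "nth_smallest U q" and ?b = "nth_smallest L' i"
  have bL: "?b \<in> L'" using nth_smallest_in[OF M'.fin_L] M'.card_L i by simp
  have "{?b..n} \<union> {1..?a} \<in> lpm_intervals n U L"
    unfolding lpm_intervals_def M.row_intervals_eq using q by force
  moreover have "?b \<in> {?b..n} \<union> {1..?a}" using bL M'.L_sub by auto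
  ultimately obtain J where J: "J \<in> lpm_intervals n U' L'" "?b \<in> J" "J \<subseteq> {?b..n} \<union> {1..?a}"
    using covering_interval by blast
  \<comment> \<open>The element \<open>?b - 1\<close> lies strictly between \<open>?a\<close> and \<open>?b\<close>, hence outside the row interval; but an
    interval of \<open>M'\<close> through \<open>?b\<close> other than the one that starts there contains \<open>?b - 1\<close>.\<close>
  have gap: "?a < nth_smallest U' i" "nth_smallest U' i < ?b" using Uless M'.row_strict[OF i] by simp_all
  show False
  proof (cases "J \<in> column_intervals n U' L'")
    case True
    then obtain j where j: "j < n - k'" "J = {nth_smallest ({1..n} - L') j..nth_smallest ({1..n} - U') j}"
      unfolding M'.column_intervals_eq by blast
    have "nth_smallest ({1..n} - L') j \<noteq> ?b" using nth_smallest_in[of "{1..n} - L'" j] M'.card_gaps j bL by auto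
    then have "?b - 1 \<in> J" using j J(2) by auto
    then show False using subsetD[OF J(3), of "?b - 1"] gap by auto
  next
    case False
    then obtain j where j: "j < k'" "J = {nth_smallest L' j..n} \<union> {1..nth_smallest U' j}"
      using J(1) unfolding lpm_intervals_def M'.row_intervals_eq by blast
    have "1 \<le> nth_smallest U' j" using nth_smallest_in[OF M'.fin_U] M'.card_U j M'.U_sub by force
    have "nth_smallest U' j \<in> J" using j \<open>1 \<le> nth_smallest U' j\<close> by simp
    moreover have "nth_smallest U' i \<notin> J" using J(3) gap by auto
    ultimately have "j < i"
      using j nth_smallest_mono[OF M'.fin_U, of i j] M'.card_U \<open>1 \<le> nth_smallest U' j\<close> gap
      by (cases "i \<le> j") auto
    then have "nth_smallest L' j < ?b" "nth_smallest U' j < nth_smallest U' i"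
      using nth_smallest_less[OF M'.fin_L] nth_smallest_less[OF M'.fin_U] M'.card_L M'.card_U i by simp_all
    then have "?b - 1 \<in> J" using j bL M'.L_sub by auto
    then show False using subsetD[OF J(3), of "?b - 1"] gap by auto
  qed
qed

text \<open>
  The bound says that bases of \<open>M'\<close> are independent in \<open>M\<close>.  Complementary counts turn it into the
  statement that \<open>{y<..z}\<close> contains at least as many column intervals of \<open>M'\<close> as of \<open>M\<close>, because
  every basis of \<open>M'\<close> misses at least as many elements of \<open>{y<..z}\<close> as it contains column intervals
  of \<open>M'\<close>.
\<close>

lemma basis_count_bound:
  assumes B: "B \<in> lpm n k' U' L'" and yz: "y \<le> z" "z \<le> n"
  shows "cnt B z + cnt L y \<le> cnt U z + cnt B y"
proof (cases "cnt ({1..n} - U) z \<le> cnt ({1..n} - L) y")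
  case True
  then have "z - cnt U z \<le> y - cnt L y" using cnt_compl[OF M.U_sub] cnt_compl[OF M.L_sub] yz by simp
  moreover have "cnt B z \<le> cnt B y + (z - y)" using cnt_diff_le yz M'.basis_sub[OF B] by blast
  ultimately show ?thesis using cnt_le[OF M.U_sub, of z] cnt_le[OF M.L_sub, of y] yz by linarith
next
  case False
  \<comment> \<open>Otherwise \<open>?S\<close> numbers the column intervals of \<open>M\<close> inside \<open>{y<..z}\<close>, each of which
    contains a column interval of \<open>M'\<close> with the same start.\<close>
  let ?S = "{cnt ({1..n} - L) y..<cnt ({1..n} - U) z}" and ?S' = "{cnt ({1..n} - L') y..<cnt ({1..n} - U') z}"
  have less: "j < n - k" if "j \<in> ?S" for j
    using that cnt_le_card[of "{1..n} - U" z] M.card_gaps by simp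
  have "\<forall>j\<in>?S. \<exists>j'<n - k'. nth_smallest ({1..n} - L') j' = nth_smallest ({1..n} - L) j \<and> nth_smallest ({1..n} - U') j' \<le> nth_smallest ({1..n} - U) j"
    using same_start less by blast
  then obtain f where f: "\<And>j. j \<in> ?S \<Longrightarrow> f j < n - k'"
    "\<And>j. j \<in> ?S \<Longrightarrow> nth_smallest ({1..n} - L') (f j) = nth_smallest ({1..n} - L) j"
    "\<And>j. j \<in> ?S \<Longrightarrow> nth_smallest ({1..n} - U') (f j) \<le> nth_smallest ({1..n} - U) j" by metis
  have "inj_on f ?S"
  proof (rule inj_onI)
    fix i j assume "i \<in> ?S" "j \<in> ?S" "f i = f j"
    then have "nth_smallest ({1..n} - L) i = nth_smallest ({1..n} - L) j" using f(2) by metis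
    then show "i = j" using nth_smallest_inj[of "{1..n} - L"] less \<open>i \<in> ?S\<close> \<open>j \<in> ?S\<close> M.card_gaps
      by (auto dest!: inj_onD)
  qed
  moreover have "f ` ?S \<subseteq> ?S'"
  proof
    fix j' assume "j' \<in> f ` ?S"
    then obtain j where j: "j \<in> ?S" "j' = f j" by blast
    have "\<not> nth_smallest ({1..n} - L) j \<le> y" "nth_smallest ({1..n} - U) j \<le> z"
      using nth_smallest_le_iff[of "{1..n} - L" j y] nth_smallest_le_iff[of "{1..n} - U" j z] less[OF j(1)] M.card_gaps j(1) by auto
    then have "\<not> nth_smallest ({1..n} - L') j' \<le> y" "nth_smallest ({1..n} - U') j' \<le> z"
      using f(2,3)[OF j(1)] j(2) by auto
    then show "j' \<in> ?S'"
      using nth_smallest_le_iff[of "{1..n} - L'" j' y] nth_smallest_le_iff[of "{1..n} - U'" j' z] f(1)[OF j(1)] j(2) M'.card_gaps by auto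
  qed
  ultimately have "card ?S \<le> card ?S'" by (rule card_inj_on_le) simp
  then have "cnt ({1..n} - U) z - cnt ({1..n} - L) y \<le> cnt ({1..n} - U') z - cnt ({1..n} - L') y" by simp
  then have "(z - cnt U z) - (y - cnt L y) \<le> (z - cnt U' z) - (y - cnt L' y)" "y - cnt L y < z - cnt U z"
    using False cnt_compl[OF M.U_sub] cnt_compl[OF M.L_sub] cnt_compl[OF M'.U_sub] cnt_compl[OF M'.L_sub] yz
    by simp_all
  moreover have "cnt U z \<le> z" "cnt L y \<le> y" "cnt U' z \<le> z" "cnt L' y \<le> y"
    using cnt_le M.U_sub M.L_sub M'.U_sub M'.L_sub by blast+
  moreover have "cnt B z \<le> cnt U' z" "cnt L' y \<le> cnt B y" using M'.basisD[OF B] by blast+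
  ultimately show ?thesis by linarith
qed

text \<open>
  By the bound on counts there is always room for the next row when rows of \<open>M\<close> are assigned greedily to the
  elements of a basis of \<open>M'\<close>.  The other three comparisons between lower and upper limits hold
  because \<open>p\<close> and \<open>q\<close> increase strictly and \<open>p \<le> q\<close>.
\<close>

lemma rows_selectable:
  assumes B: "B \<in> lpm n k' U' L'"
    and p: "\<And>i. i < k' \<Longrightarrow> p i < k" "\<And>i. i < k' \<Longrightarrow> nth_smallest U (p i) = nth_smallest U' i"
    and q: "\<And>i. i < k' \<Longrightarrow> q i < k" "\<And>i. i < k' \<Longrightarrow> nth_smallest L (q i) = nth_smallest L' i"
    and pm: "\<And>s t. s < t \<Longrightarrow> t < k' \<Longrightarrow> p s < p t" and qm: "\<And>s t. s < t \<Longrightarrow> t < k' \<Longrightarrow> q s < q t"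
    and pq: "\<And>i. i < k' \<Longrightarrow> p i \<le> q i"
  shows "\<exists>j. (\<forall>s t. s < t \<longrightarrow> j s < j t) \<and> (\<forall>i<k'. p i \<le> j i \<and> j i \<le> q i \<and>
    nth_smallest U (j i) \<le> nth_smallest B i \<and> nth_smallest B i \<le> nth_smallest L (j i))"
proof -
  have subB: "B \<subseteq> {1..n}" and fB: "finite B" and cB: "card B = k'" using M'.basis_sub[OF B] by auto
  let ?b = "nth_smallest B"
  have b: "?b i \<in> {1..n}" "nth_smallest U' i \<le> ?b i" "?b i \<le> nth_smallest L' i"
    "cnt B (?b i) = Suc i" "cnt B (?b i - 1) = i" if "i < k'" for i
    using nth_smallest_in[OF fB, of i] subB B that cB M'.card_U M'.card_L
      cnt_nth_smallest[OF fB, of i] cnt_nth_smallest_pred[OF subB, of i]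
    by (auto simp: lpm_def gale_le_def)
  \<comment> \<open>Rows \<open>j\<close> of \<open>M\<close> that may serve the \<open>i\<close>-th element \<open>?b i\<close> of \<open>B\<close>: those from \<open>p i\<close> to \<open>q i\<close> whose
    range contains \<open>?b i\<close>.\<close>
  define lo hi where "lo i = max (p i) (cnt L (?b i - 1))" and "hi i = min (q i) (cnt U (?b i) - 1)" for i
  have step: "f m + (i - m) \<le> f i" if "m \<le> i" "i < k'" "\<And>s t. s < t \<Longrightarrow> t < k' \<Longrightarrow> f s < f t" for f :: "nat \<Rightarrow> nat" and m i
    using that(1,2)
  proof (induction rule: dec_induct)
    case (step t)
    then show ?case using that(3)[of t "Suc t"] by simp
  qed simp
  have room: "lo m + (i - m) \<le> hi i" if mi: "m \<le> i" "i < k'" for m i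
  proof -
    have m: "m < k'" using mi by simp
    have pi: "p i < cnt U (?b i)"
      using nth_smallest_le_iff[OF M.fin_U, of "p i" "?b i"] p[OF mi(2)] b(2)[OF mi(2)] M.card_U by simp
    have qi: "cnt L (?b m - 1) \<le> q m"
    proof -
      have "\<not> nth_smallest L (q m) \<le> ?b m - 1" using q(2)[OF m] b(1,3)[OF m] by auto
      then show ?thesis using nth_smallest_le_iff[OF M.fin_L, of "q m"] q(1)[OF m] M.card_L by simp
    qed
    have "?b m \<le> ?b i" using nth_smallest_mono[OF fB mi(1)] mi(2) cB by simp
    then have "cnt B (?b i) + cnt L (?b m - 1) \<le> cnt U (?b i) + cnt B (?b m - 1)"
      using b(1)[OF mi(2)] by (intro basis_count_bound[OF B]) auto
    then have LU: "cnt L (?b m - 1) + (i - m) < cnt U (?b i)" using b(4)[OF mi(2)] b(5)[OF m] mi by simp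
    have "p m + (i - m) \<le> p i" "q m + (i - m) \<le> q i" using step[OF mi] pm qm by blast+
    then have "p m + (i - m) \<le> q i" "p m + (i - m) \<le> cnt U (?b i) - 1"
      "cnt L (?b m - 1) + (i - m) \<le> q i" "cnt L (?b m - 1) + (i - m) \<le> cnt U (?b i) - 1"
      using pi qi LU pq[OF mi(2)] by linarith+
    then show ?thesis unfolding lo_def hi_def by (simp add: max_def)
  qed
  obtain j where j: "\<forall>i<k'. lo i \<le> j i \<and> j i \<le> hi i" "\<forall>s t. s < t \<longrightarrow> j s < j t"
    using increasing_selection[of k' lo hi] room by blast
  have "p i \<le> j i \<and> j i \<le> q i \<and> nth_smallest U (j i) \<le> ?b i \<and> ?b i \<le> nth_smallest L (j i)" if i: "i < k'" for i
  proof -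
    have ji: "p i \<le> j i" "cnt L (?b i - 1) \<le> j i" "j i \<le> q i" "j i \<le> cnt U (?b i) - 1"
      using j(1) i unfolding lo_def hi_def by auto
    have "p i < cnt U (?b i)"
      using nth_smallest_le_iff[OF M.fin_U, of "p i" "?b i"] p[OF i] b(2)[OF i] M.card_U by simp
    then have "j i < cnt U (?b i)" using ji by linarith
    moreover have jk: "j i < k" using ji(3) q(1)[OF i] by simp
    ultimately have "nth_smallest U (j i) \<le> ?b i"
      using nth_smallest_le_iff[OF M.fin_U, of "j i"] M.card_U by simp
    moreover have "\<not> nth_smallest L (j i) \<le> ?b i - 1"
      using nth_smallest_le_iff[OF M.fin_L, of "j i"] jk M.card_L ji(2) by simp
    ultimately show ?thesis using ji by auto
  qed
  then show ?thesis using j(2) by blast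
qed

text \<open>
  The matrix of the flag.  A totally nonnegative staircase matrix \<open>T\<close> represents \<open>M\<close>; row \<open>i\<close>
  of \<open>X T\<close> combines the rows \<open>p i, ..., q i\<close> of \<open>T\<close>.  By the Cauchy-Binet formula a maximal minor
  of \<open>X T\<close> is a sum of nonnegative terms, one for each choice of \<open>k'\<close> rows of \<open>T\<close>, and it is nonzero exactly
  when some choice fits both staircases.  Completing \<open>X\<close> to a square matrix \<open>Z\<close> of positive determinant
  changes the maximal minors of \<open>T\<close> by a positive factor only.
\<close>

theorem realizable: "realizable_quotient n (lpm n k' U' L') (lpm n k U L)"
proof -
  have kk: "k' \<le> k" using card_mono[OF M.fin_U U_subset] M.card_U M'.card_U by simp
  have kn: "k \<le> n" using card_mono[OF _ M.U_sub] M.card_U by simp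
  have "\<forall>i<k'. \<exists>j<k. nth_smallest U j = nth_smallest U' i" "\<forall>i<k'. \<exists>j<k. nth_smallest L j = nth_smallest L' i"
    using index_of_member[OF M.fin_U] index_of_member[OF M.fin_L] nth_smallest_in[OF M'.fin_U] nth_smallest_in[OF M'.fin_L]
      U_subset L_subset M.card_U M.card_L M'.card_U M'.card_L by (auto simp: subset_iff)
  then obtain p q where p: "\<And>i. i < k' \<Longrightarrow> p i < k" "\<And>i. i < k' \<Longrightarrow> nth_smallest U (p i) = nth_smallest U' i"
    and q: "\<And>i. i < k' \<Longrightarrow> q i < k" "\<And>i. i < k' \<Longrightarrow> nth_smallest L (q i) = nth_smallest L' i"
    by metis
  have pm: "p s < p t" if "s < t" "t < k'" for s t
  proof (rule ccontr)
    assume "\<not> p s < p t"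
    then have "nth_smallest U (p t) \<le> nth_smallest U (p s)"
      using nth_smallest_mono[OF M.fin_U] p(1) that M.card_U by simp
    then show False using nth_smallest_less[OF M'.fin_U that(1)] p(2) that M'.card_U by simp
  qed
  have qm: "q s < q t" if "s < t" "t < k'" for s t
  proof (rule ccontr)
    assume "\<not> q s < q t"
    then have "nth_smallest L (q t) \<le> nth_smallest L (q s)"
      using nth_smallest_mono[OF M.fin_L] q(1) that M.card_L by simp
    then show False using nth_smallest_less[OF M'.fin_L that(1)] q(2) that M'.card_L by simp
  qed
  have pq: "p i \<le> q i" if "i < k'" for i
    using row_begins_before_it_ends[OF that p[OF that] q[OF that]] .
  define T where "T = staircase (nth_smallest U) (nth_smallest L) (fact n)"
  define X where "X = staircase p q (fact n)"
  let ?Js = "{J. J \<subseteq> {..<k} \<and> card J = k'}"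
  have J: "finite J" "\<And>s t. s < t \<Longrightarrow> t < k' \<Longrightarrow> nth_smallest J s < nth_smallest J t"
    "\<And>t. t < k' \<Longrightarrow> nth_smallest J t < k" if "J \<in> ?Js" for J
  proof -
    show f: "finite J" using that finite_subset by blast
    show "nth_smallest J s < nth_smallest J t" if "s < t" "t < k'" for s t
      using nth_smallest_less[OF f] that \<open>J \<in> ?Js\<close> by simp
    show "nth_smallest J t < k" if "t < k'" for t
      using nth_smallest_in[OF f, of t] that \<open>J \<in> ?Js\<close> by auto
  qed
  have fact_le: "fact k' \<le> (fact n :: nat)" "fact k \<le> (fact n :: nat)"
    using kk kn by (auto intro: fact_mono_nat)
  have minorX: "0 \<le> fdet k' (\<lambda>i t. X i (c t))"
    "fdet k' (\<lambda>i t. X i (c t)) \<noteq> 0 \<longleftrightarrow> (\<forall>t<k'. p t \<le> c t \<and> c t \<le> q t)"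
    if "\<And>s t. s < t \<Longrightarrow> t < k' \<Longrightarrow> c s < c t" for c
  proof -
    have weak: "p s \<le> p t" "q s \<le> q t" if "s \<le> t" "t < k'" for s t
      using pm[of s t] qm[of s t] that by (cases "s = t"; simp)+
    show "0 \<le> fdet k' (\<lambda>i t. X i (c t))" unfolding X_def
      by (rule staircase_minor(1)) (use that weak fact_le in auto)
    show "fdet k' (\<lambda>i t. X i (c t)) \<noteq> 0 \<longleftrightarrow> (\<forall>t<k'. p t \<le> c t \<and> c t \<le> q t)" unfolding X_def
      by (rule staircase_minor(2)) (use that weak fact_le in auto)
  qed
  have minorT: "0 \<le> fdet m (\<lambda>s t. T (r s) (nth_smallest B t))"
    "fdet m (\<lambda>s t. T (r s) (nth_smallest B t)) \<noteq> 0 \<longleftrightarrow>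
      (\<forall>t<m. nth_smallest U (r t) \<le> nth_smallest B t \<and> nth_smallest B t \<le> nth_smallest L (r t))"
    if "B \<in> ksubsets n m" "m \<le> n" "\<And>s t. s < t \<Longrightarrow> t < m \<Longrightarrow> r s < r t" "\<And>t. t < m \<Longrightarrow> r t < k" for m r B
  proof -
    have B: "finite B" "card B = m" using that(1) finite_subset[of B "{1..n}"] by (auto simp: ksubsets_def)
    have mono: "r s \<le> r t" if "s \<le> t" "t < m" for s t
      using \<open>\<And>s t. s < t \<Longrightarrow> t < m \<Longrightarrow> r s < r t\<close>[of s t] that by (cases "s = t") auto
    have "fact m \<le> (fact n :: nat)" using that(2) by (rule fact_mono_nat)
    note * = staircase_minor[of m r "nth_smallest B" "nth_smallest U" "nth_smallest L" "fact n", folded T_def, OF that(3) _ _ _ this]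
    show "0 \<le> fdet m (\<lambda>s t. T (r s) (nth_smallest B t))"
      by (rule *(1)) (use B that nth_smallest_less nth_smallest_mono mono M.fin_U M.fin_L M.card_U M.card_L in auto)
    show "fdet m (\<lambda>s t. T (r s) (nth_smallest B t)) \<noteq> 0 \<longleftrightarrow>
      (\<forall>t<m. nth_smallest U (r t) \<le> nth_smallest B t \<and> nth_smallest B t \<le> nth_smallest L (r t))"
      by (rule *(2)) (use B that nth_smallest_less nth_smallest_mono mono M.fin_U M.fin_L M.card_U M.card_L in auto)
  qed
  have P: "p ` {..<k'} \<in> ?Js" "\<And>t. t < k' \<Longrightarrow> nth_smallest (p ` {..<k'}) t = p t"
  proof -
    have "inj_on p {..<k'}" by (rule linorder_inj_onI) (use pm in force)+
    then show "p ` {..<k'} \<in> ?Js" using p(1) by (auto simp: card_image)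
    show "nth_smallest (p ` {..<k'}) t = p t" if "t < k'" for t by (rule nth_smallest_unique[OF pm that])
  qed
  have "0 < fdet k' (\<lambda>i t. X i (nth_smallest (p ` {..<k'}) t))"
    using minorX[of "nth_smallest (p ` {..<k'})"] J(2)[OF P(1)] P(2) pq by (auto simp: less_le)
  then obtain Z where Z: "\<And>i. i < k' \<Longrightarrow> Z i = X i" "0 < fdet k Z"
    using extend_to_positive_det[OF kk, of "p ` {..<k'}" X] P(1) by blast
  \<comment> \<open>The top \<open>k'\<close> rows of \<open>A = Z T\<close> are \<open>X T\<close>.\<close>
  define A where "A = mat k n (\<lambda>(i, e). \<Sum>s<k. Z i s * T s (Suc e))"
  let ?A' = "submatrix A {..<k'} UNIV"
  have A: "A \<in> carrier_mat k n" by (simp add: A_def)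
  have A': "?A' \<in> carrier_mat k' n" by (rule top_rows(1)[OF A kk])
  have label: "Suc (nth_smallest B j - 1) = nth_smallest B j" "nth_smallest B j - 1 < n"
    if "B \<in> ksubsets n m" "j < m" for B m j
    using nth_smallest_in[of B j] that finite_subset[of B "{1..n}"] by (force simp: ksubsets_def)+
  have minor: "maximal_minor A B = fdet k Z * fdet k (\<lambda>s t. T s (nth_smallest B t))" if B: "B \<in> ksubsets n k" for B
  proof -
    have "maximal_minor A B = fdet k (\<lambda>i j. \<Sum>s<k. Z i s * T s (nth_smallest B j))"
      unfolding maximal_minor_eq_fdet[OF A B] by (rule fdet_cong) (use label[OF B] in \<open>simp add: A_def\<close>)
    then show ?thesis by (simp add: fdet_mult[of k Z "\<lambda>s j. T s (nth_smallest B j)"])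
  qed
  have minor': "maximal_minor ?A' B = (\<Sum>J\<in>?Js. fdet k' (\<lambda>i t. X i (nth_smallest J t)) *
      fdet k' (\<lambda>s t. T (nth_smallest J s) (nth_smallest B t)))" if B: "B \<in> ksubsets n k'" for B
  proof -
    have "maximal_minor ?A' B = fdet k' (\<lambda>i j. \<Sum>s<k. X i s * T s (nth_smallest B j))"
      unfolding maximal_minor_eq_fdet[OF A' B]
      by (rule fdet_cong) (use label[OF B] top_rows(2)[OF A kk] kk Z(1) in \<open>simp add: A_def\<close>)
    then show ?thesis by (simp add: cauchy_binet)
  qed
  have lpm_iff: "B \<in> lpm n m U0 L0 \<longleftrightarrow> B \<in> ksubsets n m \<and>
      (\<forall>t<m. nth_smallest U0 t \<le> nth_smallest B t \<and> nth_smallest B t \<le> nth_smallest L0 t)"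
    if "card U0 = m" "card L0 = m" for B m U0 L0
  proof (cases "B \<in> ksubsets n m")
    case True
    then have "card B = m" by (simp add: ksubsets_def)
    then have "gale_le U0 B \<longleftrightarrow> (\<forall>t<m. nth_smallest U0 t \<le> nth_smallest B t)"
      "gale_le B L0 \<longleftrightarrow> (\<forall>t<m. nth_smallest B t \<le> nth_smallest L0 t)"
      using that by (simp_all add: gale_le_def)
    then show ?thesis unfolding lpm_def using True by blast
  qed (simp add: lpm_def)
  have nonneg: "0 \<le> maximal_minor A B" if "B \<in> ksubsets n k" for B
    unfolding minor[OF that] using Z(2) minorT(1)[OF that kn, of "\<lambda>i. i"] by simp
  have nonzero: "maximal_minor A B \<noteq> 0 \<longleftrightarrow> B \<in> lpm n k U L" if "B \<in> ksubsets n k" for B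
    unfolding minor[OF that] lpm_iff[OF M.card_U M.card_L]
    using Z(2) minorT(2)[OF that kn, of "\<lambda>i. i"] that by simp
  have terms: "0 \<le> fdet k' (\<lambda>i t. X i (nth_smallest J t)) * fdet k' (\<lambda>s t. T (nth_smallest J s) (nth_smallest B t))"
    "fdet k' (\<lambda>i t. X i (nth_smallest J t)) * fdet k' (\<lambda>s t. T (nth_smallest J s) (nth_smallest B t)) \<noteq> 0 \<longleftrightarrow>
      (\<forall>t<k'. p t \<le> nth_smallest J t \<and> nth_smallest J t \<le> q t \<and>
        nth_smallest U (nth_smallest J t) \<le> nth_smallest B t \<and> nth_smallest B t \<le> nth_smallest L (nth_smallest J t))"
    if "B \<in> ksubsets n k'" "J \<in> ?Js" for B J
  proof -
    have kn': "k' \<le> n" using kk kn by simp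
    have mX: "0 \<le> fdet k' (\<lambda>i t. X i (nth_smallest J t))"
      "fdet k' (\<lambda>i t. X i (nth_smallest J t)) \<noteq> 0 \<longleftrightarrow>
        (\<forall>t<k'. p t \<le> nth_smallest J t \<and> nth_smallest J t \<le> q t)"
      by (rule minorX; rule J(2)[OF that(2)]; assumption)+
    have mT: "0 \<le> fdet k' (\<lambda>s t. T (nth_smallest J s) (nth_smallest B t))"
      "fdet k' (\<lambda>s t. T (nth_smallest J s) (nth_smallest B t)) \<noteq> 0 \<longleftrightarrow>
        (\<forall>t<k'. nth_smallest U (nth_smallest J t) \<le> nth_smallest B t \<and>
          nth_smallest B t \<le> nth_smallest L (nth_smallest J t))"
      by (rule minorT[OF that(1) kn']; use J(2,3)[OF that(2)] in simp)+
    show "0 \<le> fdet k' (\<lambda>i t. X i (nth_smallest J t)) * fdet k' (\<lambda>s t. T (nth_smallest J s) (nth_smallest B t))"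
      using mX(1) mT(1) by simp
    show "fdet k' (\<lambda>i t. X i (nth_smallest J t)) * fdet k' (\<lambda>s t. T (nth_smallest J s) (nth_smallest B t)) \<noteq> 0 \<longleftrightarrow>
      (\<forall>t<k'. p t \<le> nth_smallest J t \<and> nth_smallest J t \<le> q t \<and>
        nth_smallest U (nth_smallest J t) \<le> nth_smallest B t \<and> nth_smallest B t \<le> nth_smallest L (nth_smallest J t))"
      unfolding mult_eq_0_iff de_Morgan_disj mX(2) mT(2) by blast
  qed
  have finJs: "finite ?Js" by (rule finite_subset[of _ "Pow {..<k}"]) auto
  have nonneg': "0 \<le> maximal_minor ?A' B" if "B \<in> ksubsets n k'" for B
    unfolding minor'[OF that] by (rule sum_nonneg) (rule terms(1)[OF that])
  have nonzero': "maximal_minor ?A' B \<noteq> 0 \<longleftrightarrow> B \<in> lpm n k' U' L'" if B: "B \<in> ksubsets n k'" for B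
  proof
    assume "maximal_minor ?A' B \<noteq> 0"
    then obtain J where JJ: "J \<in> ?Js"
      and nz: "fdet k' (\<lambda>i t. X i (nth_smallest J t)) * fdet k' (\<lambda>s t. T (nth_smallest J s) (nth_smallest B t)) \<noteq> 0"
      unfolding minor'[OF B] by (meson sum.neutral)
    have "nth_smallest U' t \<le> nth_smallest B t \<and> nth_smallest B t \<le> nth_smallest L' t" if t: "t < k'" for t
    proof -
      have bounds: "p t \<le> nth_smallest J t" "nth_smallest J t \<le> q t"
        "nth_smallest U (nth_smallest J t) \<le> nth_smallest B t" "nth_smallest B t \<le> nth_smallest L (nth_smallest J t)"
        using nz t unfolding terms(2)[OF B JJ] by auto
      have "nth_smallest U' t \<le> nth_smallest U (nth_smallest J t)"
        using nth_smallest_mono[OF M.fin_U bounds(1)] J(3)[OF JJ t] p(2)[OF t] M.card_U by simp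
      moreover have "nth_smallest L (nth_smallest J t) \<le> nth_smallest L' t"
        using nth_smallest_mono[OF M.fin_L bounds(2)] q[OF t] M.card_L by simp
      ultimately show ?thesis using bounds by linarith
    qed
    then show "B \<in> lpm n k' U' L'" unfolding lpm_iff[OF M'.card_U M'.card_L] using B by blast
  next
    assume BM': "B \<in> lpm n k' U' L'"
    obtain j where jm: "\<And>s t. s < t \<Longrightarrow> j s < j t" and j: "\<And>i. i < k' \<Longrightarrow> p i \<le> j i \<and> j i \<le> q i \<and>
        nth_smallest U (j i) \<le> nth_smallest B i \<and> nth_smallest B i \<le> nth_smallest L (j i)"
      using rows_selectable[OF BM' p q pm qm pq] by blast
    let ?J = "j ` {..<k'}"
    have nthJ: "nth_smallest ?J t = j t" if "t < k'" for t by (rule nth_smallest_unique[OF jm that])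
    have "inj_on j {..<k'}" by (rule linorder_inj_onI) (use jm in force)+
    moreover have "?J \<subseteq> {..<k}"
    proof clarify
      fix i assume "i < k'"
      then show "j i < k" using j[of i] q(1)[of i] by simp
    qed
    ultimately have JJ: "?J \<in> ?Js" by (simp add: card_image)
    have "fdet k' (\<lambda>i t. X i (nth_smallest ?J t)) * fdet k' (\<lambda>s t. T (nth_smallest ?J s) (nth_smallest B t)) \<noteq> 0"
      unfolding terms(2)[OF B JJ] using j nthJ by simp
    then have pos: "0 < fdet k' (\<lambda>i t. X i (nth_smallest ?J t)) * fdet k' (\<lambda>s t. T (nth_smallest ?J s) (nth_smallest B t))"
      using terms(1)[OF B JJ] by (rule le_neq_trans[OF _ not_sym, rotated])
    have "0 < maximal_minor ?A' B"
      unfolding minor'[OF B] by (rule sum_pos2[OF finJs JJ]) (rule pos, rule terms(1)[OF B])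
    then show "maximal_minor ?A' B \<noteq> 0" by simp
  qed
  have rank: "A \<in> full_rank_mats k n" "?A' \<in> full_rank_mats k' n"
    by (rule full_rank_if_minor_nonzero[OF A M.U], simp only: nonzero[OF M.U] M.U_basis)
      (rule full_rank_if_minor_nonzero[OF A' M'.U], simp only: nonzero'[OF M'.U] M'.U_basis)
  have "lpm n k U L = {B \<in> ksubsets n k. maximal_minor A B \<noteq> 0}"
  proof (rule Set.set_eqI)
    show "B \<in> lpm n k U L \<longleftrightarrow> B \<in> {B \<in> ksubsets n k. maximal_minor A B \<noteq> 0}" for B
      by (cases "B \<in> ksubsets n k") (simp_all add: nonzero, simp add: lpm_def)
  qed
  then have rep: "represents k n A (lpm n k U L)" unfolding represents_def using rank(1) by (rule conjI[rotated])
  have "lpm n k' U' L' = {B \<in> ksubsets n k'. maximal_minor ?A' B \<noteq> 0}"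
  proof (rule Set.set_eqI)
    show "B \<in> lpm n k' U' L' \<longleftrightarrow> B \<in> {B \<in> ksubsets n k'. maximal_minor ?A' B \<noteq> 0}" for B
      by (cases "B \<in> ksubsets n k'") (simp_all add: nonzero', simp add: lpm_def)
  qed
  then have rep': "represents k' n ?A' (lpm n k' U' L')" unfolding represents_def using rank(2) by (rule conjI[rotated])
  have tnn: "vec_space.row_space n C \<in> tnn_grassmannian m n"
    if "C \<in> full_rank_mats m n" "\<And>B. B \<in> ksubsets n m \<Longrightarrow> 0 \<le> maximal_minor C B" for C m
    unfolding tnn_grassmannian_def using that by blast
  show ?thesis unfolding realizable_quotient_def
    using kk rep rep' tnn[OF rank(1) nonneg] tnn[OF rank(2) nonneg']
    by (intro exI[of _ k'] exI[of _ k] exI[of _ A] conjI)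
qed

end

section \<open>The equivalence\<close>

theorem theorem41:
  fixes n k' k :: nat and U' L' U L :: "nat set"
  assumes "U' \<in> ksubsets n k'" and "L' \<in> ksubsets n k'" and "gale_le U' L'"
    and "U \<in> ksubsets n k" and "L \<in> ksubsets n k" and "gale_le U L"
    and "loopless_coloopless n (lpm n k' U' L')"
    and "loopless_coloopless n (lpm n k U L)"
  shows "(matroid_quotient n (lpm n k' U' L') (lpm n k U L) \<longleftrightarrow>
            realizable_quotient n (lpm n k' U' L') (lpm n k U L)) \<and>
         (matroid_quotient n (lpm n k' U' L') (lpm n k U L) \<longleftrightarrow>
            (\<forall>I\<in>lpm_intervals n U L. \<exists>\<J>\<subseteq>lpm_intervals n U' L'. I = \<Union>\<J>))"
proof -
  have M': "lattice_path n k' U' L'" and M: "lattice_path n k U L"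
    using assms by (simp_all add: lattice_path_def)
  have "realizable_quotient n (lpm n k' U' L') (lpm n k U L) \<Longrightarrow>
      matroid_quotient n (lpm n k' U' L') (lpm n k U L)"
    by (rule realizable_imp_quotient) (use lattice_path.U_basis[OF M'] in auto)
  moreover have "matroid_quotient n (lpm n k' U' L') (lpm n k U L) \<Longrightarrow>
      \<forall>I\<in>lpm_intervals n U L. \<exists>\<J>\<subseteq>lpm_intervals n U' L'. I = \<Union>\<J>"
    using quotient_imp_intervals[OF M' M] by (intro ballI)
  moreover have "\<forall>I\<in>lpm_intervals n U L. \<exists>\<J>\<subseteq>lpm_intervals n U' L'. I = \<Union>\<J> \<Longrightarrow>
      realizable_quotient n (lpm n k' U' L') (lpm n k U L)"
  proof -
    assume cover: "\<forall>I\<in>lpm_intervals n U L. \<exists>\<J>\<subseteq>lpm_intervals n U' L'. I = \<Union>\<J>"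
    show "realizable_quotient n (lpm n k' U' L') (lpm n k U L)"
      by (rule intervals_covered.realizable, intro intervals_covered.intro M' M intervals_covered_axioms.intro)
        (rule bspec[OF cover])
  qed
  ultimately show ?thesis by (intro conjI iffI) simp_all
qed

end
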